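(* There exists a randomized algorithm that, given input $\langle G,b,u,\epsilon,\bar\kappa\rangle$, where (i) $G=([n],E)$ is a connected $d$-regular graph given as an adjacency list, (ii) $b\in\mathbb{R}^n$ is in the range of $L_G$ (equivalently, $b$ is orthogonal to the all-ones vector), (iii) $u\in[n]$ and $\epsilon>0$, and (iv) $\bar\kappa\ge 1$ is an upper bound on the condition number $\kappa(L_G)$, outputs $\hat x_u\in\mathbb{R}$ with the following guarantee: letting $x^*\eqdef L_G^+ b$ (which satisfies $L_G x^*=b$), \[ \forall u\in[n],\qquad \Pr\Big[\,|\hat x_u-x^*_u|\le \epsilon\cdot\|x^*\|_\infty\Big]\ \ge\ 1-\tfrac1s, \] and the algorithm runs in time $O(d\,\epsilon^{-2}s^3\log s)$, for a suitable $s=O\big(\bar\kappa\log(\epsilon^{-1}\bar\kappa n)\big)$.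
   Context: For a graph $G$ with adjacency matrix $A$ and diagonal degree matrix $D$, the Laplacian is $L_G=D-A$. For a PSD matrix $S$, the condition number $\kappa(S)$ is the ratio between its largest and smallest non-zero eigenvalues. $L_G^+$ denotes the Moore–Penrose pseudo-inverse: if $L_G=\sum_i\lambda_i u_iu_i^\top$ is an eigendecomposition, $L_G^+=\sum_{i:\lambda_i>0}\lambda_i^{-1}u_iu_i^\top$. The probability is over the algorithm's internal randomness. *)

theory Defs
  imports
    "HOL-Probability.Probability_Mass_Function"
    "Jordan_Normal_Form.Char_Poly"
begin

no_notation vec_nth (infixl "$" 90)


section \<open>Graphs, Laplacians and pseudo-inverses\<close>

text \<open>A finite simple graph on the vertex set \<open>{0..<n}\<close> (playing the role of \<open>[n]\<close>) is a
  symmetric irreflexive edge relation.\<close>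

definition simple_graph :: "nat \<Rightarrow> (nat \<times> nat) set \<Rightarrow> bool" where
  "simple_graph n E \<longleftrightarrow> E \<subseteq> {..<n} \<times> {..<n} \<and> sym E \<and> irrefl E"

definition graph_connected :: "nat \<Rightarrow> (nat \<times> nat) set \<Rightarrow> bool" where
  "graph_connected n E \<longleftrightarrow> (\<forall>v<n. \<forall>w<n. (v, w) \<in> E\<^sup>*)"

definition degree :: "(nat \<times> nat) set \<Rightarrow> nat \<Rightarrow> nat" where
  "degree E v = card (E `` {v})"

definition regular :: "nat \<Rightarrow> (nat \<times> nat) set \<Rightarrow> nat \<Rightarrow> bool" where
  "regular n E d \<longleftrightarrow> (\<forall>v<n. degree E v = d)"

definition adjacency_list :: "nat \<Rightarrow> (nat \<times> nat) set \<Rightarrow> (nat \<Rightarrow> nat list) \<Rightarrow> bool" where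
  "adjacency_list n E adj \<longleftrightarrow> (\<forall>v<n. distinct (adj v) \<and> set (adj v) = E `` {v})"

definition adjacency_matrix :: "nat \<Rightarrow> (nat \<times> nat) set \<Rightarrow> real mat" where
  "adjacency_matrix n E = mat n n (\<lambda>(i, j). if (i, j) \<in> E then 1 else 0)"

definition degree_matrix :: "nat \<Rightarrow> (nat \<times> nat) set \<Rightarrow> real mat" where
  "degree_matrix n E = mat n n (\<lambda>(i, j). if i = j then real (degree E i) else 0)"

definition laplacian :: "nat \<Rightarrow> (nat \<times> nat) set \<Rightarrow> real mat" where
  "laplacian n E = degree_matrix n E - adjacency_matrix n E"

definition mat_range :: "real mat \<Rightarrow> real vec set" where
  "mat_range M = (\<lambda>x. M *\<^sub>v x) ` carrier_vec (dim_col M)"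

definition linf_norm :: "real vec \<Rightarrow> real" where
  "linf_norm x = Max ((\<lambda>i. \<bar>x $ i\<bar>) ` {..<dim_vec x})"

text \<open>Meant for nonzero PSD matrices; for the zero matrix, which has no nonzero eigenvalue, the
  value is unspecified.\<close>

definition condition_number :: "real mat \<Rightarrow> real" where
  "condition_number M =
     Max {k. eigenvalue M k \<and> k \<noteq> 0} / Min {k. eigenvalue M k \<and> k \<noteq> 0}"

text \<open>The matrix \<open>\<Sum>i<n. c i *\<^sub>R (v i) (v i)\<^sup>T\<close>, written out entrywise.\<close>

definition sum_outer :: "nat \<Rightarrow> (nat \<Rightarrow> real) \<Rightarrow> (nat \<Rightarrow> real vec) \<Rightarrow> real mat" where
  "sum_outer n c v = mat n n (\<lambda>(a, b). \<Sum>i<n. c i * (v i $ a) * (v i $ b))"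

definition eigendecomposition ::
    "nat \<Rightarrow> real mat \<Rightarrow> (nat \<Rightarrow> real) \<times> (nat \<Rightarrow> real vec) \<Rightarrow> bool" where
  "eigendecomposition n M = (\<lambda>(lam, v).
     (\<forall>i<n. v i \<in> carrier_vec n) \<and>
     (\<forall>i<n. \<forall>j<n. scalar_prod (v i) (v j) = (if i = j then 1 else 0)) \<and>
     M = sum_outer n lam v)"

text \<open>The Moore--Penrose pseudo-inverse of a PSD matrix. The result does not depend on which
  eigendecomposition is chosen.\<close>

definition pinv :: "real mat \<Rightarrow> real mat" where
  "pinv M = (let n = dim_row M; (lam, v) = (SOME D. eigendecomposition n M D)
             in sum_outer n (\<lambda>i. if lam i > 0 then inverse (lam i) else 0) v)"


section \<open>Randomized algorithms\<close>

text \<open>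
  Algorithms are programs of a randomized real RAM with unit costs. The state consists of a memory
  of naturals, a memory of reals, and pointer registers that point into adjacency lists.
  Directly addressed cells act as registers; \<open>Load\<close> and \<open>Store\<close> instructions address indirectly.
  The instruction set is deliberately small: naturals can only be added and (truncatedly)
  subtracted, reals cannot be rounded to naturals, and real constants are integers.

  The input graph is accessible only through its adjacency lists, as linked lists:
  one step yields the head of the list of a vertex, the entry at a pointer, or the next cell.
  Hence reaching the \<open>i\<close>-th neighbour of a vertex takes time proportional to \<open>i\<close>.
\<close>

datatype instr =
    NConst nat nat
  | NAdd nat nat nat
  | NSub nat nat nat
  | NLoad nat nat
  | NStore nat nat
  | RConst nat int
  | RAdd nat nat nat
  | RSub nat nat nat
  | RMul nat nat nat
  | RDiv nat nat nat
  | RLoad nat nat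
  | RStore nat nat
  | ROfNat nat nat
  | ReadVec nat nat
  | PStart nat nat
  | PNext nat nat
  | PEntry nat nat
  | Rand nat nat

datatype test = NLess nat nat | RLess nat nat | PNull nat

datatype stmt =
    Instr instr
  | If test "stmt list" "stmt list"
  | While test "stmt list"

record state =
  nmem :: "nat \<Rightarrow> nat"
  rmem :: "nat \<Rightarrow> real"
  pmem :: "nat \<Rightarrow> nat list"

definition set_n :: "nat \<Rightarrow> nat \<Rightarrow> state \<Rightarrow> state" where
  "set_n x a st = st\<lparr>nmem := (nmem st)(x := a)\<rparr>"

definition set_r :: "nat \<Rightarrow> real \<Rightarrow> state \<Rightarrow> state" where
  "set_r x a st = st\<lparr>rmem := (rmem st)(x := a)\<rparr>"

definition set_p :: "nat \<Rightarrow> nat list \<Rightarrow> state \<Rightarrow> state" where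
  "set_p x a st = st\<lparr>pmem := (pmem st)(x := a)\<rparr>"

text \<open>\<open>Rand x y\<close> is the only source of randomness: a fresh uniform element of \<open>{0..<k}\<close>, where
  \<open>k\<close> is the content of cell \<open>y\<close> (0 if \<open>k = 0\<close>). In the semantics, \<open>adj\<close> and \<open>b\<close> are the
  (read-only) input graph and right-hand side.\<close>

fun exec_instr :: "(nat \<Rightarrow> nat list) \<Rightarrow> real vec \<Rightarrow> instr \<Rightarrow> state \<Rightarrow> state pmf" where
  "exec_instr adj b (NConst x k) st = return_pmf (set_n x k st)"
| "exec_instr adj b (NAdd x y z) st = return_pmf (set_n x (nmem st y + nmem st z) st)"
| "exec_instr adj b (NSub x y z) st = return_pmf (set_n x (nmem st y - nmem st z) st)"
| "exec_instr adj b (NLoad x y) st = return_pmf (set_n x (nmem st (nmem st y)) st)"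
| "exec_instr adj b (NStore x y) st = return_pmf (set_n (nmem st x) (nmem st y) st)"
| "exec_instr adj b (RConst x k) st = return_pmf (set_r x (of_int k) st)"
| "exec_instr adj b (RAdd x y z) st = return_pmf (set_r x (rmem st y + rmem st z) st)"
| "exec_instr adj b (RSub x y z) st = return_pmf (set_r x (rmem st y - rmem st z) st)"
| "exec_instr adj b (RMul x y z) st = return_pmf (set_r x (rmem st y * rmem st z) st)"
| "exec_instr adj b (RDiv x y z) st = return_pmf (set_r x (rmem st y / rmem st z) st)"
| "exec_instr adj b (RLoad x y) st = return_pmf (set_r x (rmem st (nmem st y)) st)"
| "exec_instr adj b (RStore x y) st = return_pmf (set_r (nmem st x) (rmem st y) st)"
| "exec_instr adj b (ROfNat x y) st = return_pmf (set_r x (real (nmem st y)) st)"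
| "exec_instr adj b (ReadVec x y) st =
     return_pmf (set_r x (if nmem st y < dim_vec b then b $ (nmem st y) else 0) st)"
| "exec_instr adj b (PStart p y) st = return_pmf (set_p p (adj (nmem st y)) st)"
| "exec_instr adj b (PNext p q) st = return_pmf (set_p p (tl (pmem st q)) st)"
| "exec_instr adj b (PEntry x p) st =
     return_pmf (set_n x (if pmem st p = [] then 0 else hd (pmem st p)) st)"
| "exec_instr adj b (Rand x y) st =
     map_pmf (\<lambda>a. set_n x a st)
       (if nmem st y = 0 then return_pmf 0 else pmf_of_set {..<nmem st y})"

fun eval_test :: "test \<Rightarrow> state \<Rightarrow> bool" where
  "eval_test (NLess x y) st \<longleftrightarrow> nmem st x < nmem st y"
| "eval_test (RLess x y) st \<longleftrightarrow> rmem st x < rmem st y"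
| "eval_test (PNull p) st \<longleftrightarrow> pmem st p = []"

text \<open>A configuration is the list of statements still to be executed together with the state.
  Executing one instruction or one test is one time step; the empty list means termination.\<close>

type_synonym config = "stmt list \<times> state"

fun step :: "(nat \<Rightarrow> nat list) \<Rightarrow> real vec \<Rightarrow> config \<Rightarrow> config pmf" where
  "step adj b ([], st) = return_pmf ([], st)"
| "step adj b (Instr i # cs, st) = map_pmf (\<lambda>st'. (cs, st')) (exec_instr adj b i st)"
| "step adj b (If t c1 c2 # cs, st) =
     return_pmf ((if eval_test t st then c1 else c2) @ cs, st)"
| "step adj b (While t c # cs, st) =
     return_pmf (if eval_test t st then c @ While t c # cs else cs, st)"

primrec steps :: "(nat \<Rightarrow> nat list) \<Rightarrow> real vec \<Rightarrow> nat \<Rightarrow> config \<Rightarrow> config pmf" where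
  "steps adj b 0 c = return_pmf c"
| "steps adj b (Suc k) c = bind_pmf (step adj b c) (steps adj b k)"

text \<open>The scalar inputs are placed in memory: \<open>n\<close> and \<open>u\<close> in the first two natural cells, \<open>\<epsilon>\<close> and
  the bound on the condition number in the first two real cells. The output is read off the first
  real cell.\<close>

definition init_state :: "nat \<Rightarrow> nat \<Rightarrow> real \<Rightarrow> real \<Rightarrow> state" where
  "init_state n u eps kap =
     \<lparr>nmem = (\<lambda>_. 0)(0 := n, 1 := u), rmem = (\<lambda>_. 0)(0 := eps, 1 := kap), pmem = (\<lambda>_. [])\<rparr>"

definition run :: "stmt list \<Rightarrow> nat \<Rightarrow> (nat \<Rightarrow> nat list) \<Rightarrow> real vec \<Rightarrow> nat \<Rightarrow> real \<Rightarrow> real \<Rightarrow> nat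
    \<Rightarrow> config pmf" where
  "run prog n adj b u eps kap T = steps adj b T (prog, init_state n u eps kap)"

text \<open>Worst case over the random choices: every execution has terminated after \<open>T\<close> steps.\<close>

definition halts_within :: "stmt list \<Rightarrow> nat \<Rightarrow> (nat \<Rightarrow> nat list) \<Rightarrow> real vec \<Rightarrow> nat \<Rightarrow> real \<Rightarrow> real
    \<Rightarrow> nat \<Rightarrow> bool" where
  "halts_within prog n adj b u eps kap T \<longleftrightarrow>
     (\<forall>c \<in> set_pmf (run prog n adj b u eps kap T). fst c = [])"

text \<open>The distribution of the output; independent of \<open>T\<close> as soon as \<open>halts_within\<close> holds for \<open>T\<close>.\<close>

definition output_dist :: "stmt list \<Rightarrow> nat \<Rightarrow> (nat \<Rightarrow> nat list) \<Rightarrow> real vec \<Rightarrow> nat \<Rightarrow> real \<Rightarrow> real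
    \<Rightarrow> nat \<Rightarrow> real pmf" where
  "output_dist prog n adj b u eps kap T =
     map_pmf (\<lambda>c. rmem (snd c) 0) (run prog n adj b u eps kap T)"

text \<open>The order of growth of \<open>s\<close>. The \<open>max 1\<close> only matters where the logarithm drops below 1
  (it may even be negative, for large \<open>\<epsilon>\<close>), where the usual asymptotic notation is not meaningful.\<close>

definition s_order :: "real \<Rightarrow> real \<Rightarrow> nat \<Rightarrow> real" where
  "s_order eps kap n = kap * max 1 (ln (inverse eps * kap * real n))"

definition time_order :: "nat \<Rightarrow> real \<Rightarrow> nat \<Rightarrow> real" where
  "time_order d eps s = max 1 (real d * inverse (eps\<^sup>2) * real s ^ 3 * ln (real s))"

end

theory Submission
  imports Defs "HOL-Probability.Hoeffding"
begin

no_notation vec_nth (infixl "$" 90)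
no_notation inner (infix "\<bullet>" 70)

text \<open>
  Let \<open>W = I - L / (2 d)\<close> be the transition matrix of the lazy random walk. On the range of \<open>L\<close> we have
  \<open>L\<^sup>+ b = (\<Sum>t. W\<^sup>t b) / (2 d)\<close>. Some eigenvalue of \<open>L\<close> is at least the average \<open>d\<close> of the
  diagonal, so the nonzero eigenvalues are at least \<open>d / \<kappa>\<close>, and after
  \<open>s = O(\<kappa> log (\<kappa> n / \<epsilon>))\<close> terms the remainder \<open>W\<^sup>s L\<^sup>+ b\<close> has entries at most
  \<open>\<epsilon> / 2\<close> times the maximum norm of \<open>L\<^sup>+ b\<close>. The truncated series at \<open>u\<close> is the expected sum of
  \<open>b\<close> along a lazy walk of length \<open>s\<close> started at \<open>u\<close>. As the entries of \<open>b = L (L\<^sup>+ b)\<close> are at most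
  \<open>2 d\<close> times that norm, Hoeffding's inequality shows that
  \<open>O(s\<^sup>2 log s / \<epsilon>\<^sup>2)\<close> walks suffice; each of their \<open>s\<close> steps costs \<open>O(d)\<close>.
\<close>

section \<open>The spectral theorem for real symmetric matrices\<close>

text \<open>Laziness makes all eigenvalues of the walk matrix nonnegative, so the upper end of its
  spectrum alone controls the decay, for bipartite graphs as well. The spectral estimate lives in
  the Euclidean norm, the guarantee in the maximum norm; passing between them costs a factor sqrt n,
  which goes into the logarithm of \<open>s\<close>. The accuracy \<open>eps\<close> is shared
  equally by truncation bias and sampling error. \<open>pinv\<close> is defined by a choice among
  eigendecompositions, so a spectral theorem must come first for that choice to have any property.
  The machine shapes the rest. It has neither logarithms nor rounding, so both parameters are built
  from a base 2 logarithm found by doubling, and rounding is done by counting. Probability is kept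
  apart from execution: the loops are shown to produce the recursively defined distributions
  \<open>walk_sum\<close> and \<open>iid_sum\<close> within a fixed step budget, and bias and
  concentration are studied for these distributions alone.\<close>

lemma symmetric_real_mat_has_eigenvalue:
  fixes A :: "real mat"
  assumes A: "A \<in> carrier_mat n n" and sym: "transpose_mat A = A" and n: "n > 0"
  obtains l where "eigenvalue A l"
proof -
  let ?C = "map_mat complex_of_real A"
  have C: "?C \<in> carrier_mat n n" using A by simp
  have symC: "transpose_mat ?C = ?C" using sym
    by (metis map_mat_transpose)
  have "Polynomial.degree (char_poly ?C) = n" using degree_monic_char_poly[OF C] by simp
  then have "\<not> constant (poly (char_poly ?C))" using n by (simp add: constant_degree)
  then obtain z where z: "poly (char_poly ?C) z = 0" using fundamental_theorem_of_algebra by blast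
  then have "eigenvalue ?C z" using eigenvalue_root_char_poly[OF C] by simp
  then obtain w where w: "w \<in> carrier_vec n" "w \<noteq> 0\<^sub>v n" and Cw: "?C *\<^sub>v w = z \<cdot>\<^sub>v w"
    unfolding eigenvalue_def eigenvector_def using A by auto
  have cw: "conjugate w \<in> carrier_vec n" using w by simp
  have conjC: "?C *\<^sub>v conjugate w = conjugate (?C *\<^sub>v w)"
    using A w by (intro eq_vecI) (auto simp: scalar_prod_def)
  \<comment> \<open>Evaluating the Hermitian form at \<open>w\<close> in two ways, with the matrix
    on either side, yields \<open>z = cnj z\<close>.\<close>
  have "z * (conjugate w \<bullet> w) = conjugate w \<bullet> (?C *\<^sub>v w)"
    unfolding Cw using w cw by simp
  also have "\<dots> = (?C *\<^sub>v conjugate w) \<bullet> w"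
    using transpose_vec_mult_scalar[OF C w(1) cw] symC by simp
  also have "\<dots> = cnj z * (conjugate w \<bullet> w)"
    unfolding conjC Cw using w cw by (simp add: conjugate_smult_vec)
  finally have eq: "z * (conjugate w \<bullet> w) = cnj z * (conjugate w \<bullet> w)" .
  have "conjugate w \<bullet> w = w \<bullet>c w"
    using conjugate_vec_sprod_comm[OF w(1) w(1)] by simp
  also have "\<dots> \<noteq> 0" using w by (simp add: conjugate_square_eq_0_vec)
  finally have "cnj z = z" using eq by simp
  then have zr: "z = complex_of_real (Re z)" by (simp add: complex_eq_iff)
  have "poly (map_poly complex_of_real (char_poly A)) (complex_of_real (Re z)) = 0"
    using z zr of_real_hom.char_poly_hom[OF A] by metis
  then have "poly (char_poly A) (Re z) = 0" by simp
  then have "eigenvalue A (Re z)" using eigenvalue_root_char_poly[OF A] by simp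
  then show thesis by (rule that)
qed

lemma symmetric_real_mat_has_unit_eigenvector:
  fixes A :: "real mat"
  assumes A: "A \<in> carrier_mat n n" and sym: "transpose_mat A = A" and n: "n > 0"
  obtains l v where "v \<in> carrier_vec n" "v \<bullet> v = 1" "A *\<^sub>v v = l \<cdot>\<^sub>v v"
proof -
  obtain l where "eigenvalue A l" using symmetric_real_mat_has_eigenvalue[OF assms] .
  then obtain w where w: "w \<in> carrier_vec n" "w \<noteq> 0\<^sub>v n" and Aw: "A *\<^sub>v w = l \<cdot>\<^sub>v w"
    unfolding eigenvalue_def eigenvector_def using A by auto
  have pos: "w \<bullet> w > 0" using conjugate_square_greater_0_vec[OF w(1)] w(2) by simp
  define c where "c = 1 / sqrt (w \<bullet> w)"
  have "c * c * (w \<bullet> w) = 1" using pos unfolding c_def by simp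
  then have "(c \<cdot>\<^sub>v w) \<bullet> (c \<cdot>\<^sub>v w) = 1" using w by (simp add: mult.assoc)
  moreover have "A *\<^sub>v (c \<cdot>\<^sub>v w) = l \<cdot>\<^sub>v (c \<cdot>\<^sub>v w)"
    using A w Aw by (simp add: mult_mat_vec smult_smult_assoc mult.commute)
  ultimately show thesis using that[of "c \<cdot>\<^sub>v w" l] w by simp
qed

text \<open>The witness is the Householder reflection exchanging \<open>v\<close> and the first unit vector;
  if the two coincide, then \<open>c = 2 / 0 = 0\<close> and \<open>H\<close> is the identity.\<close>

lemma symmetric_involution_with_first_column:
  fixes v :: "real vec"
  assumes v: "v \<in> carrier_vec n" and unit: "v \<bullet> v = 1" and n: "n > 0"
  obtains H where "H \<in> carrier_mat n n" "transpose_mat H = H" "H * H = 1\<^sub>m n"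
    "H *\<^sub>v unit_vec n 0 = v"
proof -
  define u where "u i = v $ i - (if i = 0 then 1 else 0)" for i
  define q where "q = (\<Sum>i\<in>{0..<n}. u i * u i)"
  define c where "c = 2 / q"
  define H where "H = mat n n (\<lambda>(i, j). (if i = j then 1 else 0) - c * u i * u j)"
  have vv: "(\<Sum>i\<in>{0..<n}. v $ i * v $ i) = 1" using unit v by (simp add: scalar_prod_def)
  have "q = (\<Sum>i\<in>{0..<n}. v $ i * v $ i - (if i = 0 then 2 * v $ i - 1 else 0))"
    unfolding q_def u_def by (intro sum.cong) (auto simp: algebra_simps)
  also have "\<dots> = 2 - 2 * v $ 0" using n vv by (simp add: sum_subtractf sum.delta)
  \<comment> \<open>Outside the degenerate case this says \<open>c * u 0 = -1\<close>, which is why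
    the reflection moves the first unit vector to \<open>v\<close>.\<close>
  finally have q: "q = - 2 * u 0" by (simp add: u_def)
  have cq: "c * c * q = 2 * c" unfolding c_def by simp
  have HC: "H \<in> carrier_mat n n" unfolding H_def by simp
  have "H * H = 1\<^sub>m n"
  proof (rule eq_matI)
    fix i j assume ij: "i < dim_row (1\<^sub>m n :: real mat)" "j < dim_col (1\<^sub>m n :: real mat)"
    then have "(H * H) $$ (i, j) = (\<Sum>k\<in>{0..<n}. ((if i = k then 1 else 0) - c * u i * u k)
        * ((if k = j then 1 else 0) - c * u k * u j))"
      unfolding H_def by (simp add: scalar_prod_def)
    also have "\<dots> = (\<Sum>k\<in>{0..<n}. (if k = i then (if i = j then 1 else 0) - c * u i * u j else 0)
        + (if k = j then - c * u i * u j else 0) + c * c * u i * u j * (u k * u k))"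
      by (intro sum.cong) (auto simp: algebra_simps)
    also have "\<dots> = ((if i = j then 1 else 0) - c * u i * u j) - c * u i * u j
        + c * c * u i * u j * q"
      using ij by (simp add: sum.distrib sum.delta q_def sum_distrib_left[symmetric])
    also have "c * c * u i * u j * q = (c * c * q) * (u i * u j)" by simp
    finally show "(H * H) $$ (i, j) = 1\<^sub>m n $$ (i, j)" using ij unfolding cq by simp
  qed (auto simp: H_def)
  moreover have "transpose_mat H = H" unfolding H_def by (intro eq_matI) auto
  moreover have "H *\<^sub>v unit_vec n 0 = v"
  proof (rule eq_vecI)
    fix i assume i: "i < dim_vec v"
    then have i': "i < n" using v by simp
    have "q = 0 \<longrightarrow> u i = 0"
      using i' unfolding q_def by (subst sum_nonneg_eq_0_iff) auto
    then have "c * u i * u 0 = - u i" unfolding c_def using q by (cases "q = 0") auto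
    then show "(H *\<^sub>v unit_vec n 0) $ i = v $ i"
      using i' n unfolding H_def by (simp add: u_def)
  qed (use v in \<open>simp add: H_def\<close>)
  ultimately show thesis using that HC by blast
qed

text \<open>Deflation: conjugating \<open>A\<close> by an orthogonal involution \<open>H\<close>
  that sends the first unit vector to a unit eigenvector makes the first row and, by symmetry, the
  first column vanish off the diagonal. The remaining block \<open>C\<close> is again symmetric and
  is diagonalized by induction; \<open>H\<close> times the extended matrix \<open>V'\<close>
  diagonalizes \<open>A\<close>.\<close>

theorem symmetric_real_mat_diagonalization:
  fixes A :: "real mat"
  assumes "A \<in> carrier_mat n n" "transpose_mat A = A"
  shows "\<exists>V D. V \<in> carrier_mat n n \<and> D \<in> carrier_mat n n \<and> diagonal_mat D \<and>
    transpose_mat V * V = 1\<^sub>m n \<and> A = V * D * transpose_mat V"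
  using assms
proof (induction n arbitrary: A)
  case 0
  then show ?case
    by (intro exI[of _ "1\<^sub>m 0"]) (auto simp: diagonal_mat_def)
next
  case (Suc n)
  let ?N = "Suc n"
  note A = Suc.prems(1) and sym = Suc.prems(2)
  obtain l v where v: "v \<in> carrier_vec ?N" "v \<bullet> v = 1" and Av: "A *\<^sub>v v = l \<cdot>\<^sub>v v"
    using symmetric_real_mat_has_unit_eigenvector[OF A sym] by blast
  obtain H where H: "H \<in> carrier_mat ?N ?N" and Ht: "transpose_mat H = H"
    and HH: "H * H = 1\<^sub>m ?N" and He: "H *\<^sub>v unit_vec ?N 0 = v"
    using symmetric_involution_with_first_column[OF v] by blast
  let ?e = "unit_vec ?N 0 :: real vec"
  define B where "B = H * A * H"
  have B: "B \<in> carrier_mat ?N ?N" unfolding B_def using H A by simp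
  have "transpose_mat B = transpose_mat H * transpose_mat (H * A)"
    unfolding B_def using H A by (intro transpose_mult[of _ ?N ?N]) auto
  also have "transpose_mat (H * A) = transpose_mat A * transpose_mat H"
    using H A by (intro transpose_mult[of _ ?N ?N]) auto
  finally have Bt: "transpose_mat B = B"
    unfolding B_def sym Ht using H A by simp
  have Hv: "H *\<^sub>v v = ?e"
    unfolding He[symmetric] using H HH by (simp add: assoc_mult_mat_vec[symmetric, of _ ?N ?N _ ?N])
  have "B *\<^sub>v ?e = H *\<^sub>v (A *\<^sub>v (H *\<^sub>v ?e))"
    unfolding B_def using H A by (simp add: assoc_mult_mat_vec[of _ ?N ?N _ ?N])
  also have "\<dots> = l \<cdot>\<^sub>v ?e"
    unfolding He Av using H v Hv by (simp add: mult_mat_vec[of _ ?N ?N])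
  finally have Be: "B *\<^sub>v ?e = l \<cdot>\<^sub>v ?e" .
  have col0: "B $$ (i, 0) = (if i = 0 then l else 0)" if "i < ?N" for i
    using arg_cong[OF Be, of "\<lambda>x. x $ i"] that B by simp
  have row0: "B $$ (0, i) = (if i = 0 then l else 0)" if "i < ?N" for i
    using col0[OF that] Bt that B by (metis carrier_matD index_transpose_mat(1) zero_less_Suc)
  define C where "C = mat n n (\<lambda>(i, j). B $$ (Suc i, Suc j))"
  define L where "L = mat 1 1 (\<lambda>_. l)"
  have C: "C \<in> carrier_mat n n" unfolding C_def by simp
  have "B $$ (Suc i, Suc j) = B $$ (Suc j, Suc i)" if "i < n" "j < n" for i j
    using that Bt B by (metis Suc_less_eq carrier_matD index_transpose_mat(1))
  then have Ct: "transpose_mat C = C" unfolding C_def by (intro eq_matI) auto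
  obtain V D where V: "V \<in> carrier_mat n n" and D: "D \<in> carrier_mat n n" and diag: "diagonal_mat D"
    and VV: "transpose_mat V * V = 1\<^sub>m n" and CVD: "C = V * D * transpose_mat V"
    using Suc.IH[OF C Ct] by blast
  let ?Z = "0\<^sub>m 1 n :: real mat" and ?Z' = "0\<^sub>m n 1 :: real mat"
  define V' where "V' = four_block_mat (1\<^sub>m 1) ?Z ?Z' V"
  define D' where "D' = four_block_mat L ?Z ?Z' D"
  have L: "L \<in> carrier_mat 1 1" unfolding L_def by simp
  have V': "V' \<in> carrier_mat ?N ?N" and D': "D' \<in> carrier_mat ?N ?N"
    unfolding V'_def D'_def using V D L by (auto intro!: four_block_carrier_mat[of _ 1 1 _ n n, simplified])
  have V't: "transpose_mat V' = four_block_mat (1\<^sub>m 1) ?Z ?Z' (transpose_mat V)"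
    unfolding V'_def using V by (subst transpose_four_block_mat[of _ 1 1 _ n _ n]) auto
  have BVD: "B = V' * D' * transpose_mat V'"
  proof -
    have V'D': "V' * D' = four_block_mat L ?Z ?Z' (V * D)"
      unfolding V'_def D'_def using V D L
      by (subst mult_four_block_mat[of _ 1 1 _ n _ n _ _ 1 _ n]) auto
    have "V' * D' * transpose_mat V' = four_block_mat L ?Z ?Z' C"
      unfolding V'D' V't CVD using V D L
      by (subst mult_four_block_mat[of _ 1 1 _ n _ n _ _ 1 _ n]) auto
    also have "\<dots> = B"
      using B L C by (intro eq_matI) (auto simp: col0 row0 L_def C_def less_Suc_eq_0_disj)
    finally show ?thesis by simp
  qed
  have V'V': "transpose_mat V' * V' = 1\<^sub>m ?N"
    unfolding V't unfolding V'_def using V VV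
    by (subst mult_four_block_mat[of _ 1 1 _ n _ n _ _ 1 _ n]) (auto simp: four_block_one_mat)
  define W where "W = H * V'"
  have W: "W \<in> carrier_mat ?N ?N" unfolding W_def using H V' by simp
  have Wt: "transpose_mat W = transpose_mat V' * H"
    unfolding W_def using H V' Ht by (simp add: transpose_mult[of _ ?N ?N])
  have V'tc: "transpose_mat V' \<in> carrier_mat ?N ?N" using V' by simp
  have "transpose_mat W * W = transpose_mat V' * (H * H) * V'"
    unfolding Wt unfolding W_def using H V' V'tc
    by (simp add: assoc_mult_mat[of _ ?N ?N _ ?N _ ?N])
  also have "\<dots> = 1\<^sub>m ?N" using HH V' V'tc V'V' by simp
  finally have WW: "transpose_mat W * W = 1\<^sub>m ?N" .
  have "A = (H * H) * A * (H * H)" using A HH by simp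
  also have "\<dots> = H * B * H"
    unfolding B_def using A H by (simp add: assoc_mult_mat[of _ ?N ?N _ ?N _ ?N])
  also have "\<dots> = W * D' * transpose_mat W"
    unfolding BVD Wt unfolding W_def using H V' D' V'tc by (simp add: assoc_mult_mat[of _ ?N ?N _ ?N _ ?N])
  finally have "A = W * D' * transpose_mat W" .
  moreover have "diagonal_mat D'"
    using diag D L unfolding D'_def diagonal_mat_def
    by (auto simp: less_Suc_eq_0_disj) blast
  ultimately show ?case using W D' WW by blast
qed

corollary eigendecomposition_exists:
  assumes M: "M \<in> carrier_mat n n" and sym: "transpose_mat M = M"
  obtains lam v where "eigendecomposition n M (lam, v)"
proof -
  obtain V D where V: "V \<in> carrier_mat n n" and D: "D \<in> carrier_mat n n" and diag: "diagonal_mat D"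
    and VV: "transpose_mat V * V = 1\<^sub>m n" and MVD: "M = V * D * transpose_mat V"
    using symmetric_real_mat_diagonalization[OF assms] by blast
  have "scalar_prod (col V i) (col V j) = (if i = j then 1 else 0)" if "i < n" "j < n" for i j
  proof -
    have "scalar_prod (col V i) (col V j) = (transpose_mat V * V) $$ (i, j)" using that V by simp
    then show ?thesis unfolding VV using that by simp
  qed
  moreover have "M = sum_outer n (\<lambda>i. D $$ (i, i)) (col V)"
  proof (rule eq_matI)
    fix a b assume "a < dim_row (sum_outer n (\<lambda>i. D $$ (i, i)) (col V))"
      "b < dim_col (sum_outer n (\<lambda>i. D $$ (i, i)) (col V))"
    then have ab: "a < n" "b < n" by (auto simp: sum_outer_def)
    have "(V * D) $$ (a, k) = V $$ (a, k) * D $$ (k, k)" if k: "k < n" for k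
    proof -
      have "(V * D) $$ (a, k) = (\<Sum>j\<in>{0..<n}. V $$ (a, j) * D $$ (j, k))"
        using ab k V D by (simp add: scalar_prod_def)
      also have "\<dots> = (\<Sum>j\<in>{0..<n}. if j = k then V $$ (a, k) * D $$ (k, k) else 0)"
        using diag k D unfolding diagonal_mat_def by (intro sum.cong) auto
      finally show ?thesis using k by simp
    qed
    moreover have "M $$ (a, b) = (\<Sum>k\<in>{0..<n}. (V * D) $$ (a, k) * V $$ (b, k))"
      unfolding MVD using ab V D
      by (subst index_mult_mat(1)) (auto simp: scalar_prod_def simp del: assoc_mult_mat intro!: sum.cong)
    ultimately have "M $$ (a, b) = (\<Sum>k\<in>{0..<n}. V $$ (a, k) * D $$ (k, k) * V $$ (b, k))"
      by simp
    also have "\<dots> = sum_outer n (\<lambda>i. D $$ (i, i)) (col V) $$ (a, b)"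
      using ab V by (auto simp: sum_outer_def lessThan_atLeast0 mult_ac intro!: sum.cong)
    finally show "M $$ (a, b) = sum_outer n (\<lambda>i. D $$ (i, i)) (col V) $$ (a, b)" .
  qed (use M in \<open>auto simp: sum_outer_def\<close>)
  ultimately have "eigendecomposition n M (\<lambda>i. D $$ (i, i), col V)"
    using V by (auto simp: eigendecomposition_def)
  then show thesis by (rule that)
qed

section \<open>Laplacians of regular graphs\<close>

lemma eigendecompositionD:
  assumes "eigendecomposition n M (lam, v)"
  shows "\<And>i. i < n \<Longrightarrow> v i \<in> carrier_vec n"
    and "\<And>i j. i < n \<Longrightarrow> j < n \<Longrightarrow> (\<Sum>a<n. v i $ a * v j $ a) = (if i = j then 1 else 0)"
    and "M = sum_outer n lam v"
proof -
  show v: "v i \<in> carrier_vec n" if "i < n" for i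
    using assms that unfolding eigendecomposition_def by auto
  show "(\<Sum>a<n. v i $ a * v j $ a) = (if i = j then 1 else 0)" if "i < n" "j < n" for i j
  proof -
    have "scalar_prod (v i) (v j) = (if i = j then 1 else 0)"
      using assms that unfolding eigendecomposition_def by auto
    then show ?thesis using v[OF that(2)] by (simp add: scalar_prod_def lessThan_atLeast0)
  qed
  show "M = sum_outer n lam v" using assms unfolding eigendecomposition_def by auto
qed

section \<open>Coordinates in an orthonormal eigenbasis\<close>

lemma sum_outer_carrier [simp]: "sum_outer n c v \<in> carrier_mat n n"
  by (simp add: sum_outer_def)

lemma sum_outer_mult_vec:
  assumes "w \<in> carrier_vec n"
  shows "sum_outer n c v *\<^sub>v w = vec n (\<lambda>a. \<Sum>i<n. c i * (\<Sum>b<n. v i $ b * w $ b) * v i $ a)"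
proof (rule eq_vecI)
  fix a assume "a < dim_vec (vec n (\<lambda>a. \<Sum>i<n. c i * (\<Sum>b<n. v i $ b * w $ b) * v i $ a))"
  then have a: "a < n" by simp
  have "(sum_outer n c v *\<^sub>v w) $ a = (\<Sum>b<n. (\<Sum>i<n. c i * (v i $ a) * (v i $ b)) * w $ b)"
    using a assms by (simp add: sum_outer_def scalar_prod_def lessThan_atLeast0)
  also have "\<dots> = (\<Sum>i<n. \<Sum>b<n. c i * (v i $ a) * (v i $ b) * w $ b)"
    unfolding sum_distrib_right by (rule sum.swap)
  also have "\<dots> = (\<Sum>i<n. c i * (\<Sum>b<n. v i $ b * w $ b) * v i $ a)"
    by (simp add: sum_distrib_left sum_distrib_right mult_ac)
  finally show "(sum_outer n c v *\<^sub>v w) $ a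
      = vec n (\<lambda>a. \<Sum>i<n. c i * (\<Sum>b<n. v i $ b * w $ b) * v i $ a) $ a" using a by simp
qed (simp add: sum_outer_def)

lemma orthonormal_coefficient:
  fixes v :: "nat \<Rightarrow> real vec"
  assumes "\<And>i j. i < n \<Longrightarrow> j < n \<Longrightarrow> (\<Sum>a<n. v i $ a * v j $ a) = (if i = j then 1 else 0)" "i < n"
  shows "(\<Sum>b<n. v i $ b * (\<Sum>j<n. \<alpha> j * v j $ b)) = \<alpha> i"
proof -
  have "(\<Sum>b<n. v i $ b * (\<Sum>j<n. \<alpha> j * v j $ b)) = (\<Sum>b<n. \<Sum>j<n. \<alpha> j * (v i $ b * v j $ b))"
    by (simp add: sum_distrib_left mult_ac)
  also have "\<dots> = (\<Sum>j<n. \<alpha> j * (\<Sum>b<n. v i $ b * v j $ b))"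
    by (subst sum.swap) (simp add: sum_distrib_left)
  also have "\<dots> = (\<Sum>j<n. if j = i then \<alpha> j else 0)"
    using assms by (intro sum.cong) auto
  finally show ?thesis using assms(2) by simp
qed

text \<open>The calculus for everything below: the Laplacian and its pseudo-inverse are both of the
  form \<open>sum_outer\<close> over the same vectors, hence both act by scaling
  coefficients.\<close>

lemma sum_outer_mult_lincomb:
  fixes v :: "nat \<Rightarrow> real vec"
  assumes "\<And>i j. i < n \<Longrightarrow> j < n \<Longrightarrow> (\<Sum>a<n. v i $ a * v j $ a) = (if i = j then 1 else 0)"
  shows "sum_outer n c v *\<^sub>v vec n (\<lambda>a. \<Sum>i<n. \<alpha> i * v i $ a) = vec n (\<lambda>a. \<Sum>i<n. c i * \<alpha> i * v i $ a)"
proof -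
  have coeff: "(\<Sum>b<n. v i $ b * vec n (\<lambda>a. \<Sum>j<n. \<alpha> j * v j $ a) $ b) = \<alpha> i" if "i < n" for i
    using orthonormal_coefficient[of n v i \<alpha>] assms that by simp
  have "(\<Sum>i<n. c i * (\<Sum>b<n. v i $ b * vec n (\<lambda>a. \<Sum>j<n. \<alpha> j * v j $ a) $ b) * v i $ a)
      = (\<Sum>i<n. c i * \<alpha> i * v i $ a)" for a
    by (intro sum.cong refl) (simp only: coeff lessThan_iff)
  then show ?thesis by (simp only: sum_outer_mult_vec[OF vec_carrier])
qed

lemma parseval:
  fixes v :: "nat \<Rightarrow> real vec"
  assumes orth: "\<And>i j. i < n \<Longrightarrow> j < n \<Longrightarrow> (\<Sum>a<n. v i $ a * v j $ a) = (if i = j then 1 else 0)"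
  shows "(\<Sum>a<n. (\<Sum>i<n. \<alpha> i * v i $ a)\<^sup>2) = (\<Sum>i<n. (\<alpha> i)\<^sup>2)"
proof -
  have "(\<Sum>a<n. (\<Sum>i<n. \<alpha> i * v i $ a)\<^sup>2)
      = (\<Sum>a<n. \<Sum>i<n. \<alpha> i * (v i $ a * (\<Sum>j<n. \<alpha> j * v j $ a)))"
    by (simp add: power2_eq_square sum_distrib_right mult.assoc)
  also have "\<dots> = (\<Sum>i<n. \<alpha> i * (\<Sum>a<n. v i $ a * (\<Sum>j<n. \<alpha> j * v j $ a)))"
    by (subst sum.swap) (simp add: sum_distrib_left)
  also have "\<dots> = (\<Sum>i<n. (\<alpha> i)\<^sup>2)"
    using orthonormal_coefficient[OF orth] by (intro sum.cong) (auto simp: power2_eq_square)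
  finally show ?thesis .
qed

lemma eigendecomposition_eigenvalue:
  assumes dec: "eigendecomposition n M (lam, v)" and i: "i < n"
  shows "M *\<^sub>v v i = lam i \<cdot>\<^sub>v v i" "v i \<noteq> 0\<^sub>v n" "eigenvalue M (lam i)"
proof -
  note D = eigendecompositionD[OF dec]
  have "v i = vec n (\<lambda>a. \<Sum>j<n. (if j = i then 1 else 0) * v j $ a)"
    using D(1)[OF i] i by (intro eq_vecI) (auto simp: if_distrib[of "\<lambda>c. c * _"] cong: if_cong)
  moreover have "M *\<^sub>v vec n (\<lambda>a. \<Sum>j<n. (if j = i then 1 else 0) * v j $ a)
      = vec n (\<lambda>a. \<Sum>j<n. lam j * (if j = i then 1 else 0) * v j $ a)"
    by (subst D(3)) (rule sum_outer_mult_lincomb[OF D(2)])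
  ultimately have "M *\<^sub>v v i = vec n (\<lambda>a. \<Sum>j<n. lam j * (if j = i then 1 else 0) * v j $ a)"
    by simp
  also have "\<dots> = lam i \<cdot>\<^sub>v v i"
    using D(1)[OF i] i
    by (intro eq_vecI) (auto simp: if_distrib[of "\<lambda>c. c * _"] if_distrib[of "\<lambda>c. _ * c"] cong: if_cong)
  finally show eq: "M *\<^sub>v v i = lam i \<cdot>\<^sub>v v i" .
  show ne: "v i \<noteq> 0\<^sub>v n" using D(2)[OF i i] by auto
  show "eigenvalue M (lam i)"
    unfolding eigenvalue_def eigenvector_def using eq ne D(1)[OF i] D(3)
    by (intro exI[of _ "v i"]) (simp add: sum_outer_def)
qed

section \<open>Entries and spectrum of the Laplacian of a regular graph\<close>

lemma laplacian_carrier [simp]: "laplacian n E \<in> carrier_mat n n"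
  unfolding laplacian_def degree_matrix_def adjacency_matrix_def
  by (intro minus_carrier_mat mat_carrier)

lemma laplacian_symmetric:
  assumes "simple_graph n E"
  shows "transpose_mat (laplacian n E) = laplacian n E"
  using assms
  by (intro eq_matI)
    (auto simp: laplacian_def degree_matrix_def adjacency_matrix_def simple_graph_def dest: symD)

lemma laplacian_mult_vec:
  assumes G: "simple_graph n E" "regular n E d" and a: "a < n" and x: "x \<in> carrier_vec n"
  shows "(laplacian n E *\<^sub>v x) $ a = real d * x $ a - (\<Sum>w\<in>E `` {a}. x $ w)"
proof -
  have sub: "E `` {a} = {w\<in>{..<n}. (a, w) \<in> E}" using G by (auto simp: simple_graph_def)
  have "(laplacian n E *\<^sub>v x) $ a
      = (\<Sum>w<n. ((if a = w then real (degree E a) else 0) - (if (a, w) \<in> E then 1 else 0)) * x $ w)"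
    using a x by (simp add: laplacian_def degree_matrix_def adjacency_matrix_def scalar_prod_def
        lessThan_atLeast0)
  also have "\<dots> = (\<Sum>w<n. (if w = a then real (degree E a) * x $ a else 0) - (if (a, w) \<in> E then x $ w else 0))"
    by (intro sum.cong) (auto simp: algebra_simps)
  also have "\<dots> = real d * x $ a - (\<Sum>w\<in>E `` {a}. x $ w)"
    using a G unfolding sub sum.inter_filter[OF finite_lessThan]
    by (simp add: sum_subtractf regular_def)
  finally show ?thesis .
qed

lemma linf_norm_ge: "a < dim_vec x \<Longrightarrow> \<bar>x $ a\<bar> \<le> linf_norm x"
  unfolding linf_norm_def by (intro Max_ge) auto

lemma linf_norm_attained:
  assumes "dim_vec x > 0"
  obtains a where "a < dim_vec x" "\<bar>x $ a\<bar> = linf_norm x"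
proof -
  have "linf_norm x \<in> (\<lambda>i. \<bar>x $ i\<bar>) ` {..<dim_vec x}"
    unfolding linf_norm_def using assms by (intro Max_in) auto
  then show thesis using that by auto
qed

lemma sum_neighbours_abs_le:
  assumes G: "simple_graph n E" "regular n E d" and a: "a < n" and x: "x \<in> carrier_vec n"
  shows "\<bar>\<Sum>w\<in>E `` {a}. x $ w\<bar> \<le> real d * linf_norm x"
proof -
  have "\<bar>\<Sum>w\<in>E `` {a}. x $ w\<bar> \<le> (\<Sum>w\<in>E `` {a}. \<bar>x $ w\<bar>)" by (rule sum_abs)
  also have "\<dots> \<le> (\<Sum>w\<in>E `` {a}. linf_norm x)"
    using G x by (intro sum_mono linf_norm_ge) (auto simp: simple_graph_def)
  also have "\<dots> = real d * linf_norm x" using G a by (simp add: regular_def degree_def)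
  finally show ?thesis .
qed

text \<open>Gershgorin's argument: the eigenvalue equation at an entry of maximal absolute value
  gives \<open>\<bar>l - d\<bar> \<le> d\<close>. The lower bound is positive
  semidefiniteness.\<close>

lemma laplacian_eigenvalue_bounds:
  assumes G: "simple_graph n E" "regular n E d" and ev: "eigenvalue (laplacian n E) l"
  shows "0 \<le> l" "l \<le> 2 * real d"
proof -
  obtain x where "x \<in> carrier_vec n" "x \<noteq> 0\<^sub>v n" and Lx: "laplacian n E *\<^sub>v x = l \<cdot>\<^sub>v x"
    using ev unfolding eigenvalue_def eigenvector_def
    by (metis carrier_matD(1) laplacian_carrier)
  note x = this
  then obtain j where j: "j < n" "x $ j \<noteq> 0" by (metis carrier_vecD eq_vecI index_zero_vec)
  then obtain a where a: "a < n" "\<bar>x $ a\<bar> = linf_norm x"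
    using linf_norm_attained[of x] x by auto
  have pos: "linf_norm x > 0" using linf_norm_ge[of j x] j x by auto
  have "l * x $ a = real d * x $ a - (\<Sum>w\<in>E `` {a}. x $ w)"
    using laplacian_mult_vec[OF G a(1) x(1)] Lx a x by simp
  then have "(l - real d) * x $ a = - (\<Sum>w\<in>E `` {a}. x $ w)" by (simp add: algebra_simps)
  then have "\<bar>l - real d\<bar> * linf_norm x = \<bar>\<Sum>w\<in>E `` {a}. x $ w\<bar>"
    using a by (metis abs_minus_cancel abs_mult)
  also have "\<dots> \<le> real d * linf_norm x" by (rule sum_neighbours_abs_le[OF G a(1) x(1)])
  finally have "\<bar>l - real d\<bar> \<le> real d" using pos by simp
  then show "0 \<le> l" "l \<le> 2 * real d" by linarith+
qed

lemma laplacian_eigenvalue_ge_degree: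
  assumes G: "simple_graph n E" "regular n E d" and n: "n > 0"
    and dec: "eigendecomposition n (laplacian n E) (lam, v)"
  obtains i where "i < n" "real d \<le> lam i"
proof -
  note D = eigendecompositionD[OF dec]
  have "real n * real d = (\<Sum>a<n. laplacian n E $$ (a, a))"
    using G by (simp add: laplacian_def degree_matrix_def adjacency_matrix_def regular_def
        simple_graph_def irrefl_def)
  also have "\<dots> = (\<Sum>a<n. \<Sum>i<n. lam i * (v i $ a * v i $ a))"
    unfolding D(3) by (simp add: sum_outer_def mult.assoc)
  also have "\<dots> = (\<Sum>i<n. lam i * (\<Sum>a<n. v i $ a * v i $ a))"
    by (subst sum.swap) (simp add: sum_distrib_left)
  also have "\<dots> = (\<Sum>i<n. lam i)" using D(2) by simp
  finally have eq: "(\<Sum>i<n. lam i) = (\<Sum>i<n. real d)" by simp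
  have "\<exists>i<n. real d \<le> lam i"
  proof (rule ccontr)
    assume "\<not> ?thesis"
    then have "(\<Sum>i<n. lam i) < (\<Sum>i<n. real d)"
      using n by (intro sum_strict_mono) auto
    then show False using eq by simp
  qed
  then show thesis using that by blast
qed

text \<open>The chain is \<open>kap * lam i \<ge> kap * Min \<ge> Max \<ge> d\<close>. Positivity of
  \<open>d\<close> places the large eigenvalue among the nonzero ones, over which \<open>Max\<close>
  and \<open>Min\<close> range.\<close>

lemma laplacian_eigenvalue_gap:
  assumes G: "simple_graph n E" "regular n E d" and d: "d > 0"
    and kap: "kap > 0" "condition_number (laplacian n E) \<le> kap"
    and dec: "eigendecomposition n (laplacian n E) (lam, v)" and i: "i < n" "lam i \<noteq> 0"
  shows "real d / kap \<le> lam i"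
proof -
  let ?S = "{k. eigenvalue (laplacian n E) k \<and> k \<noteq> 0}"
  \<comment> \<open>\<open>Max\<close> and \<open>Min\<close> are meaningful only on finite sets;
    the eigenvalues are roots of a nonzero polynomial.\<close>
  have cp: "char_poly (laplacian n E) \<noteq> 0"
    using degree_monic_char_poly[OF laplacian_carrier, of n E] by auto
  have "finite {k. poly (char_poly (laplacian n E)) k = 0}" using cp by (rule poly_roots_finite)
  then have fin: "finite ?S"
    by (rule rev_finite_subset) (auto simp: eigenvalue_root_char_poly[OF laplacian_carrier])
  have iS: "lam i \<in> ?S" using eigendecomposition_eigenvalue(3)[OF dec i(1)] i by simp
  obtain j where j: "j < n" "real d \<le> lam j"
    using laplacian_eigenvalue_ge_degree[OF G _ dec] i by auto
  then have "lam j \<in> ?S" using eigendecomposition_eigenvalue(3)[OF dec j(1)] d by auto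
  then have max: "real d \<le> Max ?S" using fin j by (meson Max_ge order_trans)
  have "Min ?S \<in> ?S" using fin iS by (intro Min_in) auto
  then have "Min ?S > 0" using laplacian_eigenvalue_bounds(1)[OF G] by force
  then have "Max ?S \<le> kap * Min ?S"
    using kap(2) unfolding condition_number_def by (simp add: pos_divide_le_eq)
  also have "\<dots> \<le> kap * lam i" using kap fin iS by (intro mult_left_mono Min_le) auto
  finally show ?thesis using max kap(1) by (simp add: pos_divide_le_eq mult.commute)
qed

text \<open>Exposes the eigendecomposition that \<open>pinv\<close> itself picked; the spectral
  arguments about the solution are carried out in that very basis.\<close>

lemma pinv_eigendecomposition:
  assumes M: "M \<in> carrier_mat n n" and sym: "transpose_mat M = M"
  obtains lam v where "eigendecomposition n M (lam, v)"
    "pinv M = sum_outer n (\<lambda>i. if lam i > 0 then inverse (lam i) else 0) v"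
proof -
  obtain lam v where lv: "(SOME D. eigendecomposition n M D) = (lam, v)" by (rule prod.exhaust)
  have "\<exists>D. eigendecomposition n M D" using eigendecomposition_exists[OF assms] by blast
  then have "eigendecomposition n M (lam, v)" unfolding lv[symmetric] by (rule someI_ex)
  moreover have "pinv M = sum_outer n (\<lambda>i. if lam i > 0 then inverse (lam i) else 0) v"
    using M lv by (simp add: pinv_def Let_def)
  ultimately show thesis by (rule that)
qed

text \<open>\<open>e r\<close> is \<open>W\<^sup>r x\<close> for \<open>x = L\<^sup>+ b\<close> and the lazy walk matrix \<open>W = I - L / (2 d)\<close>. In the
  eigenbasis, \<open>x\<close> has no component in the kernel of \<open>L\<close>, and the other eigenvalues of \<open>W\<close> lie
  in \<open>[0, 1 - 1 / (2 \<kappa>)]\<close>.\<close>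

lemma pinv_laplacian_solution:
  assumes G: "simple_graph n E" "regular n E d" and b: "b \<in> mat_range (laplacian n E)"
    and xs: "xs = pinv (laplacian n E) *\<^sub>v b"
  shows "laplacian n E *\<^sub>v xs = b" "xs \<in> carrier_vec n"
    and "d > 0 \<Longrightarrow> kap \<ge> 1 \<Longrightarrow> condition_number (laplacian n E) \<le> kap \<Longrightarrow>
      \<exists>e :: nat \<Rightarrow> nat \<Rightarrow> real. (\<forall>a<n. e 0 a = xs $ a) \<and>
        (\<forall>r. \<forall>a<n. 2 * real d * e (Suc r) a = real d * e r a + (\<Sum>w\<in>E `` {a}. e r w)) \<and>
        (\<forall>r. \<forall>a<n. \<bar>e r a\<bar> \<le> (1 - 1 / (2 * kap)) ^ r * (sqrt (real n) * linf_norm xs))"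
proof -
  let ?L = "laplacian n E"
  obtain lam v where dec: "eigendecomposition n ?L (lam, v)"
    and pinv: "pinv ?L = sum_outer n (\<lambda>i. if lam i > 0 then inverse (lam i) else 0) v"
    by (rule pinv_eigendecomposition[OF laplacian_carrier laplacian_symmetric[OF G(1)]])
  note D = eigendecompositionD[OF dec]
  have lam: "0 \<le> lam i" "lam i \<le> 2 * real d" if "i < n" for i
    using laplacian_eigenvalue_bounds[OF G eigendecomposition_eigenvalue(3)[OF dec that]] by auto
  obtain y where y: "y \<in> carrier_vec n" and bLy: "b = ?L *\<^sub>v y"
    using b unfolding mat_range_def by (auto simp: carrier_matD(2)[OF laplacian_carrier])
  define \<gamma> where "\<gamma> i = (\<Sum>a<n. v i $ a * y $ a)" for i
  define \<beta> where "\<beta> i = (if lam i > 0 then \<gamma> i else 0)" for i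
  have b': "b = vec n (\<lambda>a. \<Sum>i<n. lam i * \<gamma> i * v i $ a)"
    unfolding bLy by (subst D(3), subst sum_outer_mult_vec[OF y]) (simp add: \<gamma>_def)
  have "xs = vec n (\<lambda>a. \<Sum>i<n. (if lam i > 0 then inverse (lam i) else 0) * (lam i * \<gamma> i) * v i $ a)"
    unfolding xs pinv b' by (rule sum_outer_mult_lincomb[OF D(2)])
  also have "\<dots> = vec n (\<lambda>a. \<Sum>i<n. \<beta> i * v i $ a)"
    by (intro eq_vecI) (auto simp: \<beta>_def intro!: sum.cong)
  finally have xs': "xs = vec n (\<lambda>a. \<Sum>i<n. \<beta> i * v i $ a)" .
  then show xs_carrier: "xs \<in> carrier_vec n" by simp
  have "?L *\<^sub>v xs = vec n (\<lambda>a. \<Sum>i<n. lam i * \<beta> i * v i $ a)"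
    unfolding xs' by (subst D(3)) (rule sum_outer_mult_lincomb[OF D(2)])
  also have "\<dots> = b"
  proof -
    have "lam i * \<beta> i = lam i * \<gamma> i" if "i < n" for i
      using lam(1)[OF that] by (auto simp: \<beta>_def)
    then show ?thesis unfolding b' by (intro eq_vecI) (auto intro!: sum.cong)
  qed
  finally show "?L *\<^sub>v xs = b" .
  show "\<exists>e :: nat \<Rightarrow> nat \<Rightarrow> real. (\<forall>a<n. e 0 a = xs $ a) \<and>
        (\<forall>r. \<forall>a<n. 2 * real d * e (Suc r) a = real d * e r a + (\<Sum>w\<in>E `` {a}. e r w)) \<and>
        (\<forall>r. \<forall>a<n. \<bar>e r a\<bar> \<le> (1 - 1 / (2 * kap)) ^ r * (sqrt (real n) * linf_norm xs))"
    if d: "d > 0" and kap: "kap \<ge> 1" and cond: "condition_number ?L \<le> kap"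
  proof -
  define \<mu> where "\<mu> i = 1 - lam i / (2 * real d)" for i
  define q where "q = 1 - 1 / (2 * kap)"
  have q0: "0 \<le> q" unfolding q_def using kap by simp
  define e where "e r a = (\<Sum>i<n. \<mu> i ^ r * \<beta> i * v i $ a)" for r a
  \<comment> \<open>With adjacency matrix \<open>A\<close>,
    \<open>2 * d * W = 2 * d * I - L = d * I + A\<close>, stated without division and for
    entries.\<close>
  have "2 * real d * e (Suc r) a = real d * e r a + (\<Sum>w\<in>E `` {a}. e r w)" if a: "a < n" for r a
  proof -
    have sub: "E `` {a} \<subseteq> {..<n}" using G by (auto simp: simple_graph_def)
    have "(?L *\<^sub>v vec n (e r)) $ a = real d * e r a - (\<Sum>w\<in>E `` {a}. vec n (e r) $ w)"
      using laplacian_mult_vec[OF G a, of "vec n (e r)"] a by simp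
    also have "(\<Sum>w\<in>E `` {a}. vec n (e r) $ w) = (\<Sum>w\<in>E `` {a}. e r w)"
      using sub by (intro sum.cong) auto
    finally have 1: "(?L *\<^sub>v vec n (e r)) $ a = real d * e r a - (\<Sum>w\<in>E `` {a}. e r w)" .
    have "?L *\<^sub>v vec n (e r) = vec n (\<lambda>a. \<Sum>i<n. lam i * (\<mu> i ^ r * \<beta> i) * v i $ a)"
      unfolding e_def by (subst D(3)) (rule sum_outer_mult_lincomb[OF D(2)])
    then have 2: "(?L *\<^sub>v vec n (e r)) $ a = (\<Sum>i<n. lam i * (\<mu> i ^ r * \<beta> i) * v i $ a)" using a by simp
    have "2 * real d * e (Suc r) a = (\<Sum>i<n. 2 * real d * \<mu> i * (\<mu> i ^ r * \<beta> i * v i $ a))"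
      unfolding e_def by (simp add: sum_distrib_left mult_ac)
    also have "\<dots> = (\<Sum>i<n. 2 * real d * (\<mu> i ^ r * \<beta> i * v i $ a) - lam i * (\<mu> i ^ r * \<beta> i) * v i $ a)"
    proof (intro sum.cong refl)
      fix i
      have eq: "2 * real d * \<mu> i = 2 * real d - lam i" unfolding \<mu>_def using d by (simp add: field_simps)
      show "2 * real d * \<mu> i * (\<mu> i ^ r * \<beta> i * v i $ a)
          = 2 * real d * (\<mu> i ^ r * \<beta> i * v i $ a) - lam i * (\<mu> i ^ r * \<beta> i) * v i $ a"
        unfolding eq by (simp add: algebra_simps)
    qed
    also have "\<dots> = 2 * real d * e r a - (?L *\<^sub>v vec n (e r)) $ a"
      unfolding 2 by (simp add: e_def sum_subtractf sum_distrib_left)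
    finally show ?thesis unfolding 1 by simp
  qed
  moreover have "\<bar>e r a\<bar> \<le> q ^ r * (sqrt (real n) * linf_norm xs)" if a: "a < n" for r a
  proof -
    have "linf_norm xs \<ge> 0" using linf_norm_ge[of a xs] a xs_carrier by auto
    \<comment> \<open>The decay of single entries goes through the Euclidean norm: an entry is at
      most the 2-norm, which by Parseval contracts by \<open>q\<close> in each step, and the 2-norm
      of \<open>xs\<close> is at most \<open>sqrt n\<close> times its maximum norm.\<close>
    have "(e r a)\<^sup>2 \<le> (\<Sum>a<n. (e r a)\<^sup>2)"
      using a by (intro member_le_sum) auto
    also have "\<dots> = (\<Sum>i<n. (\<mu> i ^ r * \<beta> i)\<^sup>2)"
      unfolding e_def by (rule parseval[OF D(2)])
    also have "\<dots> \<le> (\<Sum>i<n. (q ^ r)\<^sup>2 * (\<beta> i)\<^sup>2)"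
    proof (rule sum_mono)
      fix i assume "i \<in> {..<n}"
      then have i: "i < n" by simp
      show "(\<mu> i ^ r * \<beta> i)\<^sup>2 \<le> (q ^ r)\<^sup>2 * (\<beta> i)\<^sup>2"
      proof (cases "lam i > 0")
        case True
        then have "real d / kap \<le> lam i"
          using laplacian_eigenvalue_gap[OF G d _ cond dec i] kap by simp
        then have "\<mu> i \<le> q" unfolding \<mu>_def q_def using d kap by (simp add: field_simps)
        moreover have "0 \<le> \<mu> i" unfolding \<mu>_def using lam[OF i] d by simp
        ultimately have "\<mu> i ^ r \<le> q ^ r" "0 \<le> \<mu> i ^ r" by (auto intro: power_mono)
        then show ?thesis
          using power_mono[of "\<mu> i ^ r" "q ^ r" 2]
          unfolding power_mult_distrib[of _ "\<beta> i"] by (intro mult_right_mono) auto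
      qed (simp add: \<beta>_def)
    qed
    also have "\<dots> = (q ^ r)\<^sup>2 * (\<Sum>a<n. (xs $ a)\<^sup>2)"
      unfolding xs' using parseval[OF D(2), of \<beta>] by (simp add: sum_distrib_left)
    also have "\<dots> \<le> (q ^ r)\<^sup>2 * (\<Sum>a<n. (linf_norm xs)\<^sup>2)"
    proof (intro mult_left_mono sum_mono)
      fix a assume "a \<in> {..<n}"
      then show "(xs $ a)\<^sup>2 \<le> (linf_norm xs)\<^sup>2"
        using power_mono[OF linf_norm_ge[of a xs], of 2] xs_carrier by simp
    qed simp
    also have "\<dots> = (q ^ r * (sqrt (real n) * linf_norm xs))\<^sup>2"
      by (simp add: power_mult_distrib)
    finally have "\<bar>e r a\<bar> \<le> \<bar>q ^ r * (sqrt (real n) * linf_norm xs)\<bar>"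
      by (simp add: abs_le_square_iff)
    then show ?thesis using q0 \<open>linf_norm xs \<ge> 0\<close> by simp
  qed
  moreover have "\<forall>a<n. e 0 a = xs $ a" unfolding e_def xs' by simp
  ultimately show ?thesis
    unfolding q_def by blast
  qed
qed

section \<open>The random walk estimator\<close>

text \<open>A single uniform \<open>k < 2 * d\<close> replaces both the coin of the lazy walk and
  the choice of a neighbour. It also fits linked lists: moving \<open>k\<close> cells along the list
  either ends at the \<open>k\<close>-th neighbour or runs off the end, which means staying.\<close>

definition lazy_move :: "(nat \<Rightarrow> nat list) \<Rightarrow> nat \<Rightarrow> nat \<Rightarrow> nat \<Rightarrow> nat" where
  "lazy_move adj d x k = (if k < d then adj x ! k else x)"

text \<open>The start vertex is counted, so the expectation is the sum of \<open>W^t b\<close> at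
  \<open>x\<close> over \<open>t < r\<close>. A move is drawn in every round, also after the last
  summed vertex, exactly as in the program.\<close>

primrec walk_sum :: "(nat \<Rightarrow> nat list) \<Rightarrow> nat \<Rightarrow> real vec \<Rightarrow> nat \<Rightarrow> nat \<Rightarrow> real pmf" where
  "walk_sum adj d b 0 x = return_pmf 0"
| "walk_sum adj d b (Suc r) x = bind_pmf (pmf_of_set {..<2 * d})
     (\<lambda>k. map_pmf ((+) (b $ x)) (walk_sum adj d b r (lazy_move adj d x k)))"

text \<open>The product distribution is the form to which Hoeffding's inequality applies;
  \<open>iid_sum_Suc\<close> is the form that matches a loop of the program.\<close>

definition iid_sum :: "real pmf \<Rightarrow> nat \<Rightarrow> real pmf" where
  "iid_sum p m = map_pmf (\<lambda>f. \<Sum>i<m. f i) (Pi_pmf {..<m} 0 (\<lambda>_. p))"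

lemma iid_sum_0: "iid_sum p 0 = return_pmf 0"
  by (simp add: iid_sum_def)

lemma iid_sum_Suc: "iid_sum p (Suc m) = bind_pmf p (\<lambda>y. map_pmf ((+) y) (iid_sum p m))"
proof -
  let ?P = "Pi_pmf {..<m} 0 (\<lambda>_. p)"
  have upd: "(\<Sum>i<Suc m. (f(m := y)) i) = y + (\<Sum>i<m. f i)" for f and y :: real
    by simp
  have "Pi_pmf {..<Suc m} 0 (\<lambda>_. p) = map_pmf (\<lambda>(y, f). f(m := y)) (pair_pmf p ?P)"
    unfolding lessThan_Suc by (rule Pi_pmf_insert) auto
  then have "iid_sum p (Suc m)
      = map_pmf ((\<lambda>f. \<Sum>i<Suc m. f i) \<circ> (\<lambda>(y, f). f(m := y))) (pair_pmf p ?P)"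
    unfolding iid_sum_def by (simp only: pmf.map_comp)
  also have "\<dots> = map_pmf (\<lambda>(y, f). y + (\<Sum>i<m. f i)) (pair_pmf p ?P)"
    by (intro map_pmf_cong refl) (simp only: o_apply case_prod_unfold upd)
  also have "\<dots> = bind_pmf p (\<lambda>y. map_pmf ((+) y) (iid_sum p m))"
    unfolding iid_sum_def by (simp add: pair_pmf_def map_pmf_def bind_assoc_pmf bind_return_pmf)
  finally show ?thesis .
qed

text \<open>Hoeffding's inequality for the coordinates of the product. They lie in an interval of
  length \<open>2 * c\<close>, so the squared lengths add up to \<open>4 * m * c^2\<close>.\<close>

lemma iid_sum_concentration:
  assumes bnd: "\<And>y. y \<in> set_pmf p \<Longrightarrow> \<bar>y\<bar> \<le> c" and pos: "c > 0" "m > 0" "\<delta> \<ge> 0"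
  shows "measure_pmf.prob (iid_sum p m) {z. \<bar>z - real m * measure_pmf.expectation p (\<lambda>y. y)\<bar> \<ge> \<delta>}
    \<le> 2 * exp (- (\<delta>\<^sup>2 / (2 * real m * c\<^sup>2)))"
proof -
  let ?P = "Pi_pmf {..<m} 0 (\<lambda>_. p)"
  have comp: "map_pmf (\<lambda>f. f i) ?P = p" if "i < m" for i
    using that by (simp add: Pi_pmf_component)
  have "prob_space.indep_vars (measure_pmf ?P) (\<lambda>_. count_space UNIV) (\<lambda>i f. f i) {..<m}"
    by (rule indep_vars_Pi_pmf) simp
  then have indep: "prob_space.indep_vars (measure_pmf ?P) (\<lambda>_. borel) (\<lambda>i f. f i) {..<m}"
    by (rule prob_space.indep_vars_compose2[OF measure_pmf.prob_space_axioms]) simp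
  have AE: "AE f in measure_pmf ?P. f i \<in> {- c..c}" if "i \<in> {..<m}" for i
  proof (rule AE_pmfI)
    fix f assume "f \<in> set_pmf ?P"
    then have "f i \<in> set_pmf p" using comp[of i] that by (metis imageI lessThan_iff set_map_pmf)
    then show "f i \<in> {- c..c}" using bnd[of "f i"] by (simp add: abs_le_iff minus_le_iff)
  qed
  have H: "Hoeffding_ineq (measure_pmf ?P) {..<m} (\<lambda>i f. f i) (\<lambda>_. - c) (\<lambda>_. c)"
    unfolding Hoeffding_ineq_def indep_interval_bounded_random_variables_def
      indep_interval_bounded_random_variables_axioms_def
    by (intro conjI allI impI measure_pmf.prob_space_axioms finite_lessThan indep AE)
  have exp_i: "measure_pmf.expectation ?P (\<lambda>f. f i) = measure_pmf.expectation p (\<lambda>y. y)" if "i < m" for i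
  proof -
    have "measure_pmf.expectation p (\<lambda>y. y) = measure_pmf.expectation (map_pmf (\<lambda>f. f i) ?P) (\<lambda>y. y)"
      by (simp only: comp[OF that])
    then show ?thesis by (simp only: integral_map_pmf)
  qed
  have sq: "(\<Sum>i<m. (c - - c)\<^sup>2) = real m * (4 * c\<^sup>2)" by (simp add: power2_eq_square)
  have "measure_pmf.prob (iid_sum p m) {z. \<bar>z - real m * measure_pmf.expectation p (\<lambda>y. y)\<bar> \<ge> \<delta>}
    = measure_pmf.prob ?P {f. \<delta> \<le> \<bar>(\<Sum>i<m. f i) - (\<Sum>i<m. measure_pmf.expectation ?P (\<lambda>f. f i))\<bar>}"
    unfolding iid_sum_def measure_map_pmf by (simp add: exp_i vimage_def)
  also have "\<dots> \<le> 2 * exp (- 2 * \<delta>\<^sup>2 / (\<Sum>i<m. (c - - c)\<^sup>2))"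
    using Hoeffding_ineq.Hoeffding_ineq_abs_ge[OF H pos(3)] pos unfolding sq by simp
  also have "- 2 * \<delta>\<^sup>2 / (\<Sum>i<m. (c - - c)\<^sup>2) = - (\<delta>\<^sup>2 / (2 * real m * c\<^sup>2))"
    unfolding sq using pos by (simp add: field_simps)
  finally show ?thesis .
qed

section \<open>Range and expectation of the sum along a lazy walk\<close>

lemma adjacency_list_length:
  assumes "regular n E d" "adjacency_list n E adj" "x < n"
  shows "length (adj x) = d"
  using assms distinct_card[of "adj x"] by (simp add: adjacency_list_def degree_def regular_def)

lemma lazy_move_less:
  assumes G: "simple_graph n E" "regular n E d" "adjacency_list n E adj" and x: "x < n"
  shows "lazy_move adj d x k < n"
proof (cases "k < d")
  case True
  then have "adj x ! k \<in> set (adj x)" using adjacency_list_length[OF G(2,3) x] by simp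
  then have "adj x ! k \<in> E `` {x}" using G(3) x by (simp add: adjacency_list_def)
  then show ?thesis using G(1) True by (auto simp: lazy_move_def simple_graph_def)
qed (use x in \<open>simp add: lazy_move_def\<close>)

text \<open>This is \<open>2 * d * W\<close> applied to \<open>g\<close>. Distinctness of the
  adjacency lists ensures that each neighbour is hit by exactly one \<open>k\<close>.\<close>

lemma sum_lazy_move:
  fixes g :: "nat \<Rightarrow> real"
  assumes G: "regular n E d" "adjacency_list n E adj" and x: "x < n"
  shows "(\<Sum>k<2 * d. g (lazy_move adj d x k)) = (\<Sum>w\<in>E `` {x}. g w) + real d * g x"
proof -
  have len: "length (adj x) = d" by (rule adjacency_list_length[OF G x])
  have adj: "distinct (adj x)" "set (adj x) = E `` {x}" using G x by (auto simp: adjacency_list_def)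
  have split: "{..<2 * d} = {..<d} \<union> {d..<2 * d}" by auto
  have "(\<Sum>k<2 * d. g (lazy_move adj d x k))
      = (\<Sum>k<d. g (lazy_move adj d x k)) + (\<Sum>k\<in>{d..<2 * d}. g (lazy_move adj d x k))"
    unfolding split by (rule sum.union_disjoint) auto
  also have "(\<Sum>k<d. g (lazy_move adj d x k)) = (\<Sum>k<d. g (adj x ! k))"
    by (simp add: lazy_move_def)
  also have "\<dots> = (\<Sum>w\<in>E `` {x}. g w)"
    using sum.distinct_set_conv_list[OF adj(1), of g] adj(2) len
    by (simp add: sum_list_sum_nth lessThan_atLeast0)
  also have "(\<Sum>k\<in>{d..<2 * d}. g (lazy_move adj d x k)) = real d * g x"
    by (simp add: lazy_move_def)
  finally show ?thesis .
qed

lemma lessThan_double_nonempty: "d > 0 \<Longrightarrow> {..<2 * d :: nat} \<noteq> {}"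
proof -
  assume "d > 0"
  then have "0 \<in> {..<2 * d}" by simp
  then show ?thesis by blast
qed

lemma finite_set_pmf_walk_sum: "d > 0 \<Longrightarrow> finite (set_pmf (walk_sum adj d b r x))"
  by (induction r arbitrary: x) (simp_all add: set_pmf_of_set lessThan_double_nonempty)

lemma walk_sum_bounded:
  assumes G: "simple_graph n E" "regular n E d" "adjacency_list n E adj" and d: "d > 0"
    and b: "\<And>a. a < n \<Longrightarrow> \<bar>b $ a\<bar> \<le> B"
  shows "x < n \<Longrightarrow> y \<in> set_pmf (walk_sum adj d b r x) \<Longrightarrow> \<bar>y\<bar> \<le> real r * B"
proof (induction r arbitrary: x y)
  case (Suc r)
  have "{..<2 * d} \<noteq> {}" by (rule lessThan_double_nonempty[OF d])
  then obtain k y' where y: "y = b $ x + y'" and y': "y' \<in> set_pmf (walk_sum adj d b r (lazy_move adj d x k))"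
    using Suc.prems(2) by (auto simp: set_pmf_of_set)
  have "\<bar>y'\<bar> \<le> real r * B" by (rule Suc.IH[OF lazy_move_less[OF G Suc.prems(1)] y'])
  then show ?case using b[OF Suc.prems(1)] unfolding y by (simp add: algebra_simps)
qed simp

text \<open>A telescoping sum: \<open>b = L x = 2 * d * (I - W) x\<close>, so adding
  \<open>W^t b\<close> over \<open>t < r\<close> leaves \<open>2 * d * (x - W^r x)\<close>. The
  assumptions on \<open>e\<close> describe \<open>W^r x\<close> by its recursion only, which is what
  the induction consumes.\<close>

lemma walk_sum_expectation:
  assumes G: "simple_graph n E" "regular n E d" "adjacency_list n E adj" and d: "d > 0"
    and b: "\<And>a. a < n \<Longrightarrow> b $ a = real d * x a - (\<Sum>w\<in>E `` {a}. x w)"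
    and e0: "\<And>a. a < n \<Longrightarrow> e 0 a = x a"
    and eSuc: "\<And>r a. a < n \<Longrightarrow> 2 * real d * e (Suc r) a = real d * e r a + (\<Sum>w\<in>E `` {a}. e r w)"
  shows "a < n \<Longrightarrow> measure_pmf.expectation (walk_sum adj d b r a) (\<lambda>y. y) = 2 * real d * (x a - e r a)"
proof (induction r arbitrary: a)
  case 0
  then show ?case using e0 by simp
next
  case (Suc r)
  have ne: "{..<2 * d} \<noteq> {}" by (rule lessThan_double_nonempty[OF d])
  have fin: "finite (set_pmf (walk_sum adj d b r a'))" for a' by (rule finite_set_pmf_walk_sum[OF d])
  have step: "measure_pmf.expectation (map_pmf ((+) (b $ a)) (walk_sum adj d b r (lazy_move adj d a k))) (\<lambda>y. y)
      = b $ a + 2 * real d * (x (lazy_move adj d a k) - e r (lazy_move adj d a k))" for k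
    using Suc.IH[OF lazy_move_less[OF G Suc.prems], of k]
    by (simp add: integrable_measure_pmf_finite[OF fin])
  have "measure_pmf.expectation (walk_sum adj d b (Suc r) a) (\<lambda>y. y)
    = (\<Sum>k<2 * d. measure_pmf.expectation
        (map_pmf ((+) (b $ a)) (walk_sum adj d b r (lazy_move adj d a k))) (\<lambda>y. y) /\<^sub>R real (card {..<2 * d}))"
    unfolding walk_sum.simps using fin
    by (intro pmf_expectation_bind_pmf_of_set[OF ne finite_lessThan]) (simp only: set_map_pmf finite_imageI)
  also have "\<dots>
    = (\<Sum>k<2 * d. (b $ a + 2 * real d * (x (lazy_move adj d a k) - e r (lazy_move adj d a k))) / (2 * real d))"
    by (intro sum.cong refl)
      (simp only: step real_scaleR_def divide_inverse mult.commute card_lessThan of_nat_mult of_nat_numeral)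
  also have "\<dots> = (\<Sum>k<2 * d. b $ a / (2 * real d) + (x (lazy_move adj d a k) - e r (lazy_move adj d a k)))"
    using d by (intro sum.cong) (auto simp: field_simps)
  also have "\<dots> = b $ a + (\<Sum>k<2 * d. (\<lambda>w. x w - e r w) (lazy_move adj d a k))"
    using d by (simp add: sum.distrib)
  also have "\<dots> = b $ a + ((\<Sum>w\<in>E `` {a}. x w - e r w) + real d * (x a - e r a))"
    by (subst sum_lazy_move[OF G(2,3) Suc.prems]) simp
  also have "\<dots> = 2 * real d * x a - (real d * e r a + (\<Sum>w\<in>E `` {a}. e r w))"
    unfolding b[OF Suc.prems] by (simp add: sum_subtractf algebra_simps)
  also have "\<dots> = 2 * real d * (x a - e (Suc r) a)"
    unfolding eSuc[OF Suc.prems, symmetric] by (simp add: algebra_simps)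
  finally show ?case .
qed

lemma iid_sum_zero:
  assumes "\<And>y. y \<in> set_pmf p \<Longrightarrow> y = 0"
  shows "z \<in> set_pmf (iid_sum p m) \<Longrightarrow> z = 0"
proof (induction m arbitrary: z)
  case (Suc m)
  then obtain y z' where "y \<in> set_pmf p" "z' \<in> set_pmf (iid_sum p m)" "z = y + z'"
    by (auto simp: iid_sum_Suc)
  then show ?case using assms[of y] Suc.IH[of z'] by simp
qed (simp add: iid_sum_0)

text \<open>Half of the tolerance \<open>eps * M\<close> is granted to the bias in
  \<open>mean\<close>, half to the deviation of the empirical sum. The condition on \<open>K\<close>
  turns \<open>2 * exp (- K)\<close> into the failure probability \<open>1 / s\<close>.\<close>

lemma walk_estimator_accuracy:
  assumes p: "\<And>y. y \<in> set_pmf p \<Longrightarrow> \<bar>y\<bar> \<le> real s * (2 * real d * M)"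
    and mean: "\<bar>measure_pmf.expectation p (\<lambda>y. y) / (2 * real d) - x\<bar> \<le> eps / 2 * M"
    and pos: "d > 0" "s \<ge> 2" "eps > 0" "M \<ge> 0" "m > 0"
    and K: "2 * real s \<le> exp K" and m: "8 * (real s)\<^sup>2 * K / eps\<^sup>2 \<le> real m"
  shows "measure_pmf.prob (map_pmf (\<lambda>z. z / (2 * real d * real m)) (iid_sum p m)) {y. \<bar>y - x\<bar> \<le> eps * M}
    \<ge> 1 - 1 / real s"
proof (cases "M = 0")
  \<comment> \<open>Here the range of the samples shrinks to a point and Hoeffding's bound
    degenerates, but every sample and \<open>x\<close> are 0, so the output is exact.\<close>
  case True
  have z: "z = 0" if "z \<in> set_pmf (iid_sum p m)" for z
    using iid_sum_zero[OF _ that] p True by fastforce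
  have "measure_pmf.expectation p (\<lambda>y. y) = measure_pmf.expectation p (\<lambda>_. 0)"
    using p True by (intro integral_cong_AE) (auto simp: AE_measure_pmf_iff)
  then have "x = 0" using mean True by simp
  then have "measure_pmf.prob (map_pmf (\<lambda>z. z / (2 * real d * real m)) (iid_sum p m)) {y. \<bar>y - x\<bar> \<le> eps * M} = 1"
    using z True by (subst measure_pmf.prob_eq_1) (auto simp: AE_measure_pmf_iff)
  then show ?thesis by simp
next
  case False
  then have M: "M > 0" using pos by simp
  let ?\<mu> = "measure_pmf.expectation p (\<lambda>y. y)"
  \<comment> \<open>The deviation \<open>eps / 2 * M\<close> of the estimate, scaled up by its
    denominator \<open>2 * d * m\<close>.\<close>
  define \<delta> where "\<delta> = real m * real d * eps * M"
  define c where "c = real s * (2 * real d * M)"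
  have c: "c > 0" unfolding c_def using pos M by simp
  \<comment> \<open>The constant 8 in the number of samples arises here: the Hoeffding exponent
    simplifies to \<open>m * eps^2 / (8 * s^2)\<close>, since both \<open>d\<close> and
    \<open>M\<close> cancel.\<close>
  have "K \<le> real m * eps\<^sup>2 / (8 * (real s)\<^sup>2)" using m pos by (simp add: field_simps)
  also have "\<dots> = \<delta>\<^sup>2 / (2 * real m * c\<^sup>2)"
    unfolding \<delta>_def c_def using pos M by (simp add: field_simps power2_eq_square)
  finally have expo: "K \<le> \<delta>\<^sup>2 / (2 * real m * c\<^sup>2)" .
  have "measure_pmf.prob (iid_sum p m) {z. \<bar>z - real m * ?\<mu>\<bar> \<ge> \<delta>} \<le> 2 * exp (- (\<delta>\<^sup>2 / (2 * real m * c\<^sup>2)))"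
    using p pos c by (intro iid_sum_concentration) (auto simp: c_def \<delta>_def M less_imp_le)
  also have "\<dots> \<le> 2 * exp (- K)" using expo by simp
  also have "\<dots> \<le> 1 / real s" using K pos by (simp add: exp_minus field_simps)
  finally have bad: "measure_pmf.prob (iid_sum p m) {z. \<bar>z - real m * ?\<mu>\<bar> \<ge> \<delta>} \<le> 1 / real s" .
  have "1 - 1 / real s \<le> 1 - measure_pmf.prob (iid_sum p m) {z. \<bar>z - real m * ?\<mu>\<bar> \<ge> \<delta>}" using bad by simp
  also have "\<dots> = measure_pmf.prob (iid_sum p m) (UNIV - {z. \<bar>z - real m * ?\<mu>\<bar> \<ge> \<delta>})"
    by (subst measure_pmf.prob_compl[symmetric]) auto
  also have "\<dots> \<le> measure_pmf.prob (iid_sum p m) ((\<lambda>z. z / (2 * real d * real m)) -` {y. \<bar>y - x\<bar> \<le> eps * M})"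
  proof (intro measure_pmf.finite_measure_mono subsetI vimageI2 CollectI)
    fix z assume "z \<in> UNIV - {z. \<bar>z - real m * ?\<mu>\<bar> \<ge> \<delta>}"
    then have zd: "\<bar>z - real m * ?\<mu>\<bar> \<le> \<delta>" by simp
    have "z / (2 * real d * real m) - ?\<mu> / (2 * real d) = (z - real m * ?\<mu>) / (2 * real d * real m)"
      using pos by (simp add: field_simps)
    then have "\<bar>z / (2 * real d * real m) - ?\<mu> / (2 * real d)\<bar> = \<bar>z - real m * ?\<mu>\<bar> / (2 * real d * real m)"
      by (simp add: abs_mult)
    also have "\<dots> \<le> \<delta> / (2 * real d * real m)" using zd pos by (intro divide_right_mono) auto
    also have "\<dots> = eps / 2 * M" unfolding \<delta>_def using pos by simp
    finally have "\<bar>z / (2 * real d * real m) - ?\<mu> / (2 * real d)\<bar> \<le> eps / 2 * M" .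
    then show "\<bar>z / (2 * real d * real m) - x\<bar> \<le> eps * M" using mean by linarith
  qed simp
  finally show ?thesis by simp
qed

section \<open>Walk length and number of walks\<close>

lemma ex_power2_ge: "\<exists>i. (x :: real) \<le> 2 ^ i"
  using real_arch_pow[of 2 x] by (auto intro: less_imp_le)

text \<open>The rounded-up base 2 logarithm, and 0 for \<open>x \<le> 1\<close>, in the form in
  which repeated doubling from 1 finds it.\<close>

definition ceil_log :: "real \<Rightarrow> nat" where
  "ceil_log x = (LEAST i. x \<le> 2 ^ i)"

lemma le_power_ceil_log: "x \<le> 2 ^ ceil_log x"
  unfolding ceil_log_def by (rule LeastI_ex[OF ex_power2_ge])

lemma power_less_of_less_ceil_log: "i < ceil_log x \<Longrightarrow> 2 ^ i < x"
  unfolding ceil_log_def using not_less_Least[of i "\<lambda>i. x \<le> 2 ^ i"] by auto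

lemma ceil_log_le: "x \<le> 2 ^ i \<Longrightarrow> ceil_log x \<le> i"
  unfolding ceil_log_def by (rule Least_le)

text \<open>Since \<open>e \<ge> 2\<close>, the extra 1 in the exponent pays for the factor 2. It is
  used both for the truncation error, with \<open>x = n * kap / eps\<close>, and for the failure
  probability, with \<open>x = s\<close>.\<close>

lemma exp_ceil_log: "2 * x \<le> exp (1 + real (ceil_log x))"
proof -
  have e: "2 \<le> exp (1 :: real)" using exp_ge_add_one_self[of "1 :: real"] by simp
  have "x \<le> 2 ^ ceil_log x" by (rule le_power_ceil_log)
  also have "\<dots> \<le> exp 1 ^ ceil_log x" using e by (intro power_mono) auto
  also have "\<dots> = exp (real (ceil_log x))" by (simp flip: exp_of_nat_mult)
  finally have "2 * x \<le> 2 * exp (real (ceil_log x))" by simp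
  also have "\<dots> \<le> exp 1 * exp (real (ceil_log x))" using e by (intro mult_right_mono) auto
  finally show ?thesis by (simp add: exp_add)
qed

lemma ln_le_ceil_log: "x > 0 \<Longrightarrow> ln x \<le> real (ceil_log x)"
proof -
  assume x: "x > 0"
  have "ln x \<le> ln (2 ^ ceil_log x)" using le_power_ceil_log[of x] x by simp
  also have "\<dots> = real (ceil_log x) * ln 2" by (simp add: ln_realpow)
  also have "\<dots> \<le> real (ceil_log x) * 1" using ln_le_minus_one[of 2] by (intro mult_left_mono) auto
  finally show ?thesis by simp
qed

text \<open>Minimality bounds the power just below \<open>x\<close>; the factor \<open>3 / 2\<close>
  comes from \<open>ln 2 \<ge> 2 / 3\<close>.\<close>

lemma ceil_log_le_ln:
  assumes "x > 0"
  shows "real (ceil_log x) \<le> 1 + 3 / 2 * max 0 (ln x)"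
proof (cases "ceil_log x")
  case (Suc i)
  then have "2 ^ i < x" by (intro power_less_of_less_ceil_log) simp
  then have "ln (2 ^ i) \<le> ln x" using assms by simp
  then have "real i * ln 2 \<le> ln x" by (simp add: ln_realpow)
  moreover have "real i * (2 / 3) \<le> real i * ln 2"
    using ln2_ge_two_thirds by (intro mult_left_mono) auto
  ultimately have "real i \<le> 3 / 2 * ln x" by simp
  then show ?thesis using Suc by (simp add: max_def)
qed simp

text \<open>The factor \<open>2 * kap\<close> is the reciprocal of the decay rate
  \<open>1 / (2 * kap)\<close>, so the remaining factor is the exponent achieved after that many
  steps.\<close>

definition walk_length :: "real \<Rightarrow> real \<Rightarrow> nat \<Rightarrow> nat" where
  "walk_length eps kap n = nat \<lceil>2 * kap * (1 + real (ceil_log (real n * kap / eps)))\<rceil>"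

lemma walk_length_ge: "2 * kap * (1 + real (ceil_log (real n * kap / eps))) \<le> real (walk_length eps kap n)"
  unfolding walk_length_def by linarith

text \<open>Lets the time bound absorb the cost of computing the logarithm, and gives
  \<open>s \<ge> 2\<close>.\<close>

lemma walk_length_ge_logs:
  assumes "kap \<ge> 1"
  shows "2 + 2 * ceil_log (real n * kap / eps) \<le> walk_length eps kap n"
proof -
  have "2 * 1 * (1 + real (ceil_log (real n * kap / eps))) \<le> 2 * kap * (1 + real (ceil_log (real n * kap / eps)))"
    using assms by (intro mult_right_mono) auto
  then have "real (2 + 2 * ceil_log (real n * kap / eps)) \<le> real (walk_length eps kap n)"
    using walk_length_ge[of kap n eps] by simp
  then show ?thesis by (simp only: of_nat_le_iff)
qed

text \<open>The \<open>max 1\<close> in \<open>s_order\<close> absorbs the additive constants and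
  the change of base of the logarithm; rounding adds at most 1, which is at most
  \<open>s_order\<close>.\<close>

lemma walk_length_order:
  assumes "eps > 0" "kap \<ge> 1" "n \<ge> 1"
  shows "2 \<le> walk_length eps kap n" "s_order eps kap n \<le> real (walk_length eps kap n)"
    "real (walk_length eps kap n) \<le> 12 * s_order eps kap n"
proof -
  let ?z = "real n * kap / eps"
  let ?c = "real (ceil_log ?z)"
  have z: "?z > 0" using assms by simp
  have so: "s_order eps kap n = kap * max 1 (ln ?z)"
    unfolding s_order_def by (simp add: divide_inverse mult_ac)
  show "2 \<le> walk_length eps kap n" using walk_length_ge_logs[OF assms(2), of n eps] by linarith
  have "kap * max 1 (ln ?z) \<le> kap * (2 * (1 + ?c))"
    using ln_le_ceil_log[OF z] assms by (intro mult_left_mono) auto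
  then show "s_order eps kap n \<le> real (walk_length eps kap n)"
    using walk_length_ge[of kap n eps] so by (simp add: mult_ac)
  have "1 \<le> kap * max 1 (ln ?z)" using assms mult_mono[of 1 kap 1 "max 1 (ln ?z)"] by simp
  moreover have "kap * (1 + ?c) \<le> kap * (4 * max 1 (ln ?z))"
    using ceil_log_le_ln[OF z] assms by (intro mult_left_mono) auto
  moreover have "0 \<le> 2 * kap * (1 + ?c)" using assms by simp
  then have "real (walk_length eps kap n) \<le> 2 * kap * (1 + ?c) + 1"
    unfolding walk_length_def by linarith
  ultimately show "real (walk_length eps kap n) \<le> 12 * s_order eps kap n"
    unfolding so by linarith
qed

text \<open>From \<open>1 - t \<le> exp (- t)\<close> and the choice of the length, the power is at
  most \<open>1 / (2 * z)\<close> with \<open>z = n * kap / eps\<close>; the factor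
  \<open>sqrt n\<close> is then swallowed by \<open>n * kap\<close>.\<close>

lemma walk_length_decay:
  assumes "eps > 0" "kap \<ge> 1" "n \<ge> 1"
  shows "(1 - 1 / (2 * kap)) ^ walk_length eps kap n * sqrt (real n) \<le> eps / 2"
proof -
  let ?s = "walk_length eps kap n" and ?z = "real n * kap / eps"
  have "(1 - 1 / (2 * kap)) ^ ?s \<le> exp (- (1 / (2 * kap))) ^ ?s"
    using assms exp_ge_add_one_self[of "- (1 / (2 * kap))"] by (intro power_mono) auto
  also have "\<dots> = exp (- (real ?s / (2 * kap)))" by (simp flip: exp_of_nat_mult)
  also have "\<dots> \<le> exp (- (1 + real (ceil_log ?z)))"
  proof -
    have "1 + real (ceil_log ?z) \<le> real ?s / (2 * kap)"
      using walk_length_ge[of kap n eps] assms by (subst pos_le_divide_eq) (auto simp: mult.commute)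
    then show ?thesis by simp
  qed
  also have "\<dots> = 1 / exp (1 + real (ceil_log ?z))" by (simp only: exp_minus inverse_eq_divide)
  also have "\<dots> \<le> 1 / (2 * ?z)"
    using exp_ceil_log[of ?z] assms by (intro divide_left_mono) auto
  also have "\<dots> = eps / (2 * real n * kap)" by simp
  finally have "(1 - 1 / (2 * kap)) ^ ?s * sqrt (real n) \<le> eps / (2 * real n * kap) * sqrt (real n)"
    by (intro mult_right_mono) auto
  also have "\<dots> \<le> eps / (2 * real n * kap) * (real n * kap)"
  proof (intro mult_left_mono)
    have "sqrt (real n) \<le> sqrt (real n) * sqrt (real n)"
      using mult_left_mono[of 1 "sqrt (real n)" "sqrt (real n)"] assms by simp
    also have "\<dots> = real n * 1" by simp
    also have "\<dots> \<le> real n * kap" using assms by (intro mult_left_mono) auto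
    finally show "sqrt (real n) \<le> real n * kap" .
  qed (use assms in simp)
  also have "\<dots> = eps / 2" using assms by simp
  finally show ?thesis .
qed

text \<open>The sample size demanded by \<open>walk_estimator_accuracy\<close>, with
  \<open>K\<close> supplied by \<open>exp_ceil_log\<close>.\<close>

definition num_walks :: "real \<Rightarrow> nat \<Rightarrow> nat" where
  "num_walks eps s = nat \<lceil>8 * (real s)\<^sup>2 * (1 + real (ceil_log (real s))) / eps\<^sup>2\<rceil>"

lemma num_walks_ge: "8 * (real s)\<^sup>2 * (1 + real (ceil_log (real s))) / eps\<^sup>2 \<le> real (num_walks eps s)"
  unfolding num_walks_def by linarith

lemma num_walks_bounds:
  assumes s: "s \<ge> 2" and eps: "0 < eps" "eps < 1"
  shows "1 \<le> num_walks eps s" "real (num_walks eps s) \<le> 45 * (real s)\<^sup>2 * ln (real s) / eps\<^sup>2"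
proof -
  let ?K = "1 + real (ceil_log (real s))"
  have s2: "1 \<le> (real s)\<^sup>2" using s by simp
  have e2: "eps\<^sup>2 \<le> 1" using eps by (simp add: power_le_one)
  have "1 \<le> (real s)\<^sup>2 * ?K" using mult_mono[of 1 "(real s)\<^sup>2" 1 ?K] s2 by simp
  then have one: "1 \<le> (real s)\<^sup>2 * ?K / eps\<^sup>2" using e2 eps by (simp add: pos_le_divide_eq)
  then have "8 \<le> 8 * (real s)\<^sup>2 * ?K / eps\<^sup>2" by simp
  then show "1 \<le> num_walks eps s" using num_walks_ge[of s eps] by linarith
  \<comment> \<open>Rounding raises the factor 8 to 9. Next, \<open>?K \<le> 5 * ln s\<close>
    because the additive 2 is at most \<open>3 * ln s\<close>; this gives 45.\<close>
  have "real (num_walks eps s) \<le> 8 * (real s)\<^sup>2 * ?K / eps\<^sup>2 + 1"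
    unfolding num_walks_def using \<open>8 \<le> 8 * (real s)\<^sup>2 * ?K / eps\<^sup>2\<close> by linarith
  also have "\<dots> \<le> 9 * ((real s)\<^sup>2 * ?K / eps\<^sup>2)" using one by simp
  also have "\<dots> \<le> 9 * ((real s)\<^sup>2 * (5 * ln (real s)) / eps\<^sup>2)"
  proof -
    have "ln 2 \<le> ln (real s)" using s by simp
    then have "2 / 3 \<le> ln (real s)" using ln2_ge_two_thirds by linarith
    then have "?K \<le> 5 * ln (real s)" using ceil_log_le_ln[of "real s"] s by simp
    then show ?thesis by (intro mult_left_mono divide_right_mono) auto
  qed
  finally show "real (num_walks eps s) \<le> 45 * (real s)\<^sup>2 * ln (real s) / eps\<^sup>2" by simp
qed

section \<open>Simulation of programs by abstract distributions\<close>

lemma set_state_simps [simp]: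
  "nmem (set_n x a st) = (nmem st)(x := a)" "rmem (set_n x a st) = rmem st"
  "pmem (set_n x a st) = pmem st"
  "nmem (set_r x c st) = nmem st" "rmem (set_r x c st) = (rmem st)(x := c)"
  "pmem (set_r x c st) = pmem st"
  "nmem (set_p x l st) = nmem st" "rmem (set_p x l st) = rmem st"
  "pmem (set_p x l st) = (pmem st)(x := l)"
  by (simp_all add: set_n_def set_r_def set_p_def)

text \<open>\<open>J\<close> is the joint distribution of running time and final state; \<open>R\<close> couples it with
  an abstract distribution \<open>A\<close>. Quantifying over the continuation \<open>cs'\<close> makes the notion
  compositional, and \<open>N \<le> k\<close> ensures that no run of \<open>cs\<close> is cut off.\<close>

definition simulates ::
    "(nat \<Rightarrow> nat list) \<Rightarrow> real vec \<Rightarrow> stmt list \<Rightarrow> state \<Rightarrow> nat \<Rightarrow> (state \<Rightarrow> 'a \<Rightarrow> bool) \<Rightarrow> 'a pmf \<Rightarrow> bool"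
  where
  "simulates adj b cs st N R A \<longleftrightarrow> (\<exists>J :: (nat \<times> state) pmf.
     rel_pmf (\<lambda>(t, st') a. t \<le> N \<and> R st' a) J A \<and>
     (\<forall>cs' k. N \<le> k \<longrightarrow>
        steps adj b k (cs @ cs', st) = bind_pmf J (\<lambda>(t, st'). steps adj b (k - t) (cs', st'))))"

lemma simulates_Nil:
  assumes "R st a"
  shows "simulates adj b [] st 0 R (return_pmf a)"
  unfolding simulates_def
  by (rule exI[of _ "return_pmf (0, st)"]) (simp add: assms bind_return_pmf)

lemma simulates_mono:
  assumes "simulates adj b cs st N R A" "N \<le> N'" "\<And>st' a. a \<in> set_pmf A \<Longrightarrow> R st' a \<Longrightarrow> R' st' a"
  shows "simulates adj b cs st N' R' A"
proof -
  obtain J where J: "rel_pmf (\<lambda>(t, st') a. t \<le> N \<and> R st' a) J A"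
    and eq: "\<And>cs' k. N \<le> k \<Longrightarrow>
        steps adj b k (cs @ cs', st) = bind_pmf J (\<lambda>(t, st'). steps adj b (k - t) (cs', st'))"
    using assms(1) unfolding simulates_def by blast
  have "rel_pmf (\<lambda>(t, st') a. t \<le> N' \<and> R' st' a) J A"
    by (rule pmf.rel_mono_strong[OF J]) (use assms in \<open>auto intro: le_trans\<close>)
  then show ?thesis unfolding simulates_def using eq assms(2) by (meson le_trans)
qed

text \<open>The behaviour of \<open>c2\<close> depends on the concrete final state of
  \<open>c1\<close>, its abstract counterpart \<open>B\<close> only on the abstract value. Hence the
  joint distribution is built over the coupling \<open>pq\<close> of the two, where a state and a
  value related by \<open>R1\<close> are available together; running times add.\<close>

lemma simulates_append:
  assumes "simulates adj b c1 st N1 R1 A"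
    and "\<And>st' a. a \<in> set_pmf A \<Longrightarrow> R1 st' a \<Longrightarrow> simulates adj b c2 st' N2 R2 (B a)"
  shows "simulates adj b (c1 @ c2) st (N1 + N2) R2 (bind_pmf A B)"
proof -
  obtain J where J: "rel_pmf (\<lambda>(t, st') a. t \<le> N1 \<and> R1 st' a) J A"
    and eq: "\<And>cs' k. N1 \<le> k \<Longrightarrow>
        steps adj b k (c1 @ cs', st) = bind_pmf J (\<lambda>(t, st'). steps adj b (k - t) (cs', st'))"
    using assms(1) unfolding simulates_def by blast
  obtain pq where pq: "\<And>x a. (x, a) \<in> set_pmf pq \<Longrightarrow> fst x \<le> N1 \<and> R1 (snd x) a"
    and J_def: "map_pmf fst pq = J" and A_def: "map_pmf snd pq = A"
  proof -
    from J obtain pq where "\<And>x a. (x, a) \<in> set_pmf pq \<Longrightarrow> case x of (t, st') \<Rightarrow> t \<le> N1 \<and> R1 st' a"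
      "map_pmf fst pq = J" "map_pmf snd pq = A"
      by (cases rule: rel_pmf.cases) blast
    then show thesis by (intro that[of pq]) (auto simp: case_prod_unfold)
  qed
  have "\<forall>x a. \<exists>J'. (x, a) \<in> set_pmf pq \<longrightarrow>
      rel_pmf (\<lambda>(t, st') a'. t \<le> N2 \<and> R2 st' a') J' (B a) \<and>
      (\<forall>cs' k. N2 \<le> k \<longrightarrow>
        steps adj b k (c2 @ cs', snd x) = bind_pmf J' (\<lambda>(t, st'). steps adj b (k - t) (cs', st')))"
  proof (intro allI)
    fix x a
    show "\<exists>J'. (x, a) \<in> set_pmf pq \<longrightarrow>
      rel_pmf (\<lambda>(t, st') a'. t \<le> N2 \<and> R2 st' a') J' (B a) \<and>
      (\<forall>cs' k. N2 \<le> k \<longrightarrow>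
        steps adj b k (c2 @ cs', snd x) = bind_pmf J' (\<lambda>(t, st'). steps adj b (k - t) (cs', st')))"
    proof (cases "(x, a) \<in> set_pmf pq")
      case True
      then have "a \<in> set_pmf A" unfolding A_def[symmetric] by force
      then have "simulates adj b c2 (snd x) N2 R2 (B a)"
        using assms(2) pq[OF True] by blast
      then show ?thesis unfolding simulates_def by blast
    qed simp
  qed
  then obtain J2 where J2: "\<And>x a. (x, a) \<in> set_pmf pq \<Longrightarrow>
      rel_pmf (\<lambda>(t, st') a'. t \<le> N2 \<and> R2 st' a') (J2 x a) (B a)"
    and eq2: "\<And>x a cs' k. (x, a) \<in> set_pmf pq \<Longrightarrow> N2 \<le> k \<Longrightarrow>
        steps adj b k (c2 @ cs', snd x)
          = bind_pmf (J2 x a) (\<lambda>(t, st'). steps adj b (k - t) (cs', st'))"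
    by metis
  define J' where "J' = bind_pmf pq (\<lambda>(x, a). map_pmf (map_prod ((+) (fst x)) id) (J2 x a))"
  have "rel_pmf (\<lambda>(t, st') a. t \<le> N1 + N2 \<and> R2 st' a) J' (bind_pmf pq (\<lambda>(x, a). B a))"
    unfolding J'_def
  proof (rule rel_pmf_bindI[where R = "\<lambda>z z'. z' = z \<and> z \<in> set_pmf pq"])
    show "rel_pmf (\<lambda>z z'. z' = z \<and> z \<in> set_pmf pq) pq pq"
      by (rule rel_pmf_reflI) simp
  next
    fix z z' assume z: "z' = z \<and> z \<in> set_pmf pq"
    obtain x a where za: "z = (x, a)" by (cases z)
    have "fst x \<le> N1" using pq z za by blast
    then have "rel_pmf (\<lambda>y a. (\<lambda>(t, st') a. t \<le> N1 + N2 \<and> R2 st' a) (map_prod ((+) (fst x)) id y) a)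
        (J2 x a) (B a)"
      using z za by (intro pmf.rel_mono_strong[OF J2]) (auto split: prod.splits)
    then show "rel_pmf (\<lambda>(t, st') a. t \<le> N1 + N2 \<and> R2 st' a)
        (case z of (x, a) \<Rightarrow> map_pmf (map_prod ((+) (fst x)) id) (J2 x a)) (case z' of (x, a) \<Rightarrow> B a)"
      using z za by (simp add: pmf.rel_map)
  qed
  also have "bind_pmf pq (\<lambda>(x, a). B a) = bind_pmf A B"
    unfolding A_def[symmetric] by (simp add: bind_map_pmf case_prod_unfold)
  finally have rel: "rel_pmf (\<lambda>(t, st') a. t \<le> N1 + N2 \<and> R2 st' a) J' (bind_pmf A B)" .
  have "steps adj b k ((c1 @ c2) @ cs', st) = bind_pmf J' (\<lambda>(t, st'). steps adj b (k - t) (cs', st'))"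
    if k: "N1 + N2 \<le> k" for cs' k
  proof -
    have "steps adj b k ((c1 @ c2) @ cs', st)
        = bind_pmf pq (\<lambda>(x, a). steps adj b (k - fst x) (c2 @ cs', snd x))"
      using eq[of k "c2 @ cs'"] k unfolding J_def[symmetric] by (simp add: bind_map_pmf case_prod_unfold)
    also have "\<dots> = bind_pmf pq (\<lambda>(x, a). bind_pmf (J2 x a)
        (\<lambda>(t, st'). steps adj b (k - fst x - t) (cs', st')))"
    proof (rule bind_pmf_cong[OF refl])
      fix z assume z: "z \<in> set_pmf pq"
      obtain t s a where zeq: "z = ((t, s), a)" by (metis prod.exhaust)
      have "t \<le> N1" using pq z zeq by fastforce
      then have "N2 \<le> k - t" using k by linarith
      from eq2[of "(t, s)" a, OF _ this] z zeq
      show "(case z of (x, a) \<Rightarrow> steps adj b (k - fst x) (c2 @ cs', snd x)) = (case z of (x, a) \<Rightarrow>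
          bind_pmf (J2 x a) (\<lambda>(t, st'). steps adj b (k - fst x - t) (cs', st')))" by simp
    qed
    also have "\<dots> = bind_pmf J' (\<lambda>(t, st'). steps adj b (k - t) (cs', st'))"
      unfolding J'_def by (simp add: bind_assoc_pmf bind_map_pmf case_prod_unfold)
    finally show ?thesis .
  qed
  then show ?thesis unfolding simulates_def using rel by blast
qed

text \<open>Common source of the rules for all statements. \<open>p\<close> distributes the random
  choice made in the step, not the resulting state, so that the abstract continuation
  \<open>B\<close> may depend on the choice.\<close>

lemma simulates_step:
  assumes step: "\<And>cs'. step adj b (cs @ cs', st) = map_pmf (\<lambda>x. (c x @ cs', f x)) p"
    and sim: "\<And>x. x \<in> set_pmf p \<Longrightarrow> simulates adj b (c x) (f x) N R (B x)"
  shows "simulates adj b cs st (Suc N) R (bind_pmf p B)"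
proof -
  have "\<forall>x. \<exists>J. x \<in> set_pmf p \<longrightarrow> rel_pmf (\<lambda>(t, st') a. t \<le> N \<and> R st' a) J (B x) \<and>
     (\<forall>cs' k. N \<le> k \<longrightarrow>
        steps adj b k (c x @ cs', f x) = bind_pmf J (\<lambda>(t, st'). steps adj b (k - t) (cs', st')))"
    using sim unfolding simulates_def by blast
  then obtain J where J: "\<And>x. x \<in> set_pmf p \<Longrightarrow>
      rel_pmf (\<lambda>(t, st') a. t \<le> N \<and> R st' a) (J x) (B x)"
    and eq: "\<And>x cs' k. x \<in> set_pmf p \<Longrightarrow> N \<le> k \<Longrightarrow>
        steps adj b k (c x @ cs', f x) = bind_pmf (J x) (\<lambda>(t, st'). steps adj b (k - t) (cs', st'))"
    by metis
  define J' where "J' = bind_pmf p (\<lambda>x. map_pmf (map_prod Suc id) (J x))"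
  have "rel_pmf (\<lambda>(t, st') a. t \<le> Suc N \<and> R st' a) J' (bind_pmf p B)"
    unfolding J'_def
  proof (rule rel_pmf_bindI[where R = "\<lambda>z z'. z' = z \<and> z \<in> set_pmf p"])
    show "rel_pmf (\<lambda>z z'. z' = z \<and> z \<in> set_pmf p) p p"
      by (rule rel_pmf_reflI) simp
  next
    fix z z' assume z: "z' = z \<and> z \<in> set_pmf p"
    have "rel_pmf (\<lambda>y a. (\<lambda>(t, st') a. t \<le> Suc N \<and> R st' a) (map_prod Suc id y) a) (J z) (B z)"
      using z by (intro pmf.rel_mono_strong[OF J]) (auto split: prod.splits)
    then show "rel_pmf (\<lambda>(t, st') a. t \<le> Suc N \<and> R st' a) (map_pmf (map_prod Suc id) (J z)) (B z')"
      using z by (simp add: pmf.rel_map)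
  qed
  moreover have "steps adj b k (cs @ cs', st) = bind_pmf J' (\<lambda>(t, st'). steps adj b (k - t) (cs', st'))"
    if k: "Suc N \<le> k" for cs' k
  proof -
    obtain k' where k': "k = Suc k'" "N \<le> k'" using k by (cases k) auto
    have "steps adj b k (cs @ cs', st) = bind_pmf p (\<lambda>x. steps adj b k' (c x @ cs', f x))"
      by (simp add: k' step bind_map_pmf)
    also have "\<dots> = bind_pmf p (\<lambda>x. bind_pmf (J x) (\<lambda>(t, st'). steps adj b (k' - t) (cs', st')))"
      by (rule bind_pmf_cong[OF refl]) (use eq k' in simp)
    also have "\<dots> = bind_pmf J' (\<lambda>(t, st'). steps adj b (k - t) (cs', st'))"
      unfolding J'_def k' by (simp add: bind_assoc_pmf bind_map_pmf case_prod_unfold)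
    finally show ?thesis .
  qed
  ultimately show ?thesis unfolding simulates_def by blast
qed

lemma simulates_Instr:
  assumes "exec_instr adj b i st = return_pmf st'" "simulates adj b cs st' N R A"
  shows "simulates adj b (Instr i # cs) st (Suc N) R A"
  using simulates_step[of adj b "Instr i # cs" st "\<lambda>_. cs" "\<lambda>_. st'" "return_pmf ()" N R "\<lambda>_. A"] assms
  by (simp add: bind_return_pmf)

lemma simulates_Rand:
  assumes "nmem st y > 0" "\<And>k. k < nmem st y \<Longrightarrow> simulates adj b cs (set_n x k st) N R (B k)"
  shows "simulates adj b (Instr (Rand x y) # cs) st (Suc N) R (bind_pmf (pmf_of_set {..<nmem st y}) B)"
proof (rule simulates_step[where c = "\<lambda>_. cs" and f = "\<lambda>k. set_n x k st"])
  have "{..<nmem st y} \<noteq> {}" using assms(1) by auto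
  then show "simulates adj b cs (set_n x k st) N R (B k)" if "k \<in> set_pmf (pmf_of_set {..<nmem st y})" for k
    using that assms(2) by simp
qed (use assms(1) in \<open>simp add: pmf.map_comp o_def\<close>)

lemma simulates_If:
  assumes "simulates adj b ((if eval_test t st then c1 else c2) @ cs) st N R A"
  shows "simulates adj b (If t c1 c2 # cs) st (Suc N) R A"
  using simulates_step[of adj b "If t c1 c2 # cs" st "\<lambda>_. (if eval_test t st then c1 else c2) @ cs"
      "\<lambda>_. st" "return_pmf ()" N R "\<lambda>_. A"] assms
  by (simp add: bind_return_pmf)

lemma simulates_While:
  assumes "simulates adj b (if eval_test t st then c @ While t c # cs else cs) st N R A"
  shows "simulates adj b (While t c # cs) st (Suc N) R A"
  using simulates_step[of adj b "While t c # cs" st "\<lambda>_. if eval_test t st then c @ While t c # cs else cs"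
      "\<lambda>_. st" "return_pmf ()" N R "\<lambda>_. A"] assms
  by (simp add: bind_return_pmf)

lemma steps_Nil: "steps adj b k ([], st) = return_pmf ([], st)"
  by (induction k) (simp_all add: bind_return_pmf)

text \<open>With the empty continuation, the steps left over after termination change nothing, so
  every run ends in the empty list by time \<open>T\<close>.\<close>

lemma simulates_run:
  assumes "simulates adj b prog (init_state n u eps kap) T (\<lambda>st y. rmem st 0 = y) A"
  shows "halts_within prog n adj b u eps kap T" "output_dist prog n adj b u eps kap T = A"
proof -
  obtain J where J: "rel_pmf (\<lambda>(t, st') y. t \<le> T \<and> rmem st' 0 = y) J A"
    and eq: "\<And>cs' k. T \<le> k \<Longrightarrow> steps adj b k (prog @ cs', init_state n u eps kap)
        = bind_pmf J (\<lambda>(t, st'). steps adj b (k - t) (cs', st'))"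
    using assms unfolding simulates_def by blast
  have run: "run prog n adj b u eps kap T = map_pmf (\<lambda>x. ([], snd x)) J"
    using eq[of T "[]"] unfolding run_def by (simp add: steps_Nil case_prod_unfold map_pmf_def)
  show "halts_within prog n adj b u eps kap T"
    unfolding halts_within_def run by auto
  have "rel_pmf (=) (map_pmf (\<lambda>x. rmem (snd x) 0) J) A"
    unfolding pmf.rel_map by (rule pmf.rel_mono_strong[OF J]) auto
  then show "output_dist prog n adj b u eps kap T = A"
    unfolding output_dist_def run by (simp add: pmf.map_comp o_def pmf.rel_eq)
qed


section \<open>Derived rules for instructions, tests and the deterministic loops\<close>

lemma simulates_weaken: "simulates adj b cs st N R A \<Longrightarrow> N \<le> N' \<Longrightarrow> simulates adj b cs st N' R A"
  by (rule simulates_mono)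

lemma simulates_map:
  assumes "simulates adj b cs st N (\<lambda>st' y. R st' (f y)) A"
  shows "simulates adj b cs st N R (map_pmf f A)"
  using assms unfolding simulates_def by (simp add: pmf.rel_map case_prod_unfold)

text \<open>Numbered as the equations of \<open>exec_instr\<close>: 1 to 3 are
  \<open>NConst\<close>, \<open>NAdd\<close>, \<open>NSub\<close>; 6 and 7 are
  \<open>RConst\<close>, \<open>RAdd\<close>; 13 to 17 are \<open>ROfNat\<close>,
  \<open>ReadVec\<close>, \<open>PStart\<close>, \<open>PNext\<close>,
  \<open>PEntry\<close>.\<close>

lemmas simulates_det = exec_instr.simps(1-17)[THEN simulates_Instr]

lemma simulates_If_True:
  "eval_test t st \<Longrightarrow> simulates adj b (c1 @ cs) st N R A \<Longrightarrow> simulates adj b (If t c1 c2 # cs) st (Suc N) R A"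
  by (simp add: simulates_If)

lemma simulates_If_False:
  "\<not> eval_test t st \<Longrightarrow> simulates adj b (c2 @ cs) st N R A \<Longrightarrow> simulates adj b (If t c1 c2 # cs) st (Suc N) R A"
  by (simp add: simulates_If)

lemma simulates_While_True:
  "eval_test t st \<Longrightarrow> simulates adj b (c @ While t c # cs) st N R A
    \<Longrightarrow> simulates adj b (While t c # cs) st (Suc N) R A"
  by (simp add: simulates_While)

lemma simulates_While_False:
  "\<not> eval_test t st \<Longrightarrow> simulates adj b cs st N R A \<Longrightarrow> simulates adj b (While t c # cs) st (Suc N) R A"
  by (simp add: simulates_While)

text \<open>The loop rules name the final state by an explicit term; these equations and the
  following ones identify the terms obtained before and after one more round.\<close>

lemma set_state_same:
  "rmem st x = c \<Longrightarrow> set_r x c st = st" "nmem st x = a \<Longrightarrow> set_n x a st = st"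
  "pmem st x = l \<Longrightarrow> set_p x l st = st"
  by (auto simp: set_r_def set_n_def set_p_def)

lemma set_state_overwrite:
  "set_r x c (set_r x c' st) = set_r x c st" "set_n x a (set_n x a' st) = set_n x a st"
  "set_p x l (set_p x l' st) = set_p x l st"
  by (simp_all add: set_r_def set_n_def set_p_def)

lemma set_r_commute: "x \<noteq> y \<Longrightarrow> set_r x c (set_r y c' st) = set_r y c' (set_r x c st)"
  by (simp add: set_r_def fun_upd_twist)

lemma set_state_commute:
  "set_n x a (set_r y c st) = set_r y c (set_n x a st)"
  "set_p x l (set_r y c st) = set_r y c (set_p x l st)"
  "set_n x a (set_p y l st) = set_p y l (set_n x a st)"
  by (simp_all add: set_r_def set_n_def set_p_def)

text \<open>The counter \<open>c\<close> is a real register and starts at 1, so it ends with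
  \<open>1 + ceil_log\<close>, the factor that occurs in both parameters.\<close>

definition doubling_loop :: "nat \<Rightarrow> nat \<Rightarrow> nat \<Rightarrow> nat \<Rightarrow> stmt" where
  "doubling_loop p q c o1 = While (RLess p q) [Instr (RAdd p p p), Instr (RAdd c c o1)]"

text \<open>Induction on the rounds left. The loop is deterministic, so the rule hands one explicit
  final state to the rest of the program \<open>cs\<close>.\<close>

lemma simulates_doubling_loop_aux:
  assumes regs: "p \<noteq> q" "c \<noteq> p" "c \<noteq> q" "o1 \<noteq> p" "o1 \<noteq> c"
  shows "rmem st p = 2 ^ i \<Longrightarrow> rmem st c = 1 + real i \<Longrightarrow> rmem st o1 = 1 \<Longrightarrow> rmem st q = z \<Longrightarrow>
    i \<le> ceil_log z \<Longrightarrow>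
    simulates adj b cs (set_r c (1 + real (ceil_log z)) (set_r p (2 ^ ceil_log z) st)) N R A \<Longrightarrow>
    simulates adj b (doubling_loop p q c o1 # cs) st (3 * (ceil_log z - i) + 1 + N) R A"
proof (induction "ceil_log z - i" arbitrary: i st)
  case 0
  then have i: "i = ceil_log z" by simp
  have "set_r c (1 + real (ceil_log z)) (set_r p (2 ^ ceil_log z) st) = st"
    using 0 i by (simp add: set_state_same)
  then have "simulates adj b cs st N R A" using 0 by simp
  moreover have "\<not> eval_test (RLess p q) st"
    using 0 i le_power_ceil_log[of z] by simp
  ultimately have "simulates adj b (doubling_loop p q c o1 # cs) st (Suc N) R A"
    unfolding doubling_loop_def by (intro simulates_While_False)
  then show ?case using i by simp
next
  case (Suc k)
  then have i: "i < ceil_log z" by simp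
  let ?st = "set_r c (1 + real (Suc i)) (set_r p (2 ^ Suc i) st)"
  have st: "set_r c (1 + real (ceil_log z)) (set_r p (2 ^ ceil_log z) ?st)
      = set_r c (1 + real (ceil_log z)) (set_r p (2 ^ ceil_log z) st)"
    using regs by (simp add: set_r_commute[of p c] set_state_overwrite)
  have cont: "simulates adj b cs (set_r c (1 + real (ceil_log z)) (set_r p (2 ^ ceil_log z) ?st)) N R A"
    unfolding st by (rule Suc.prems(6))
  have loop: "simulates adj b (doubling_loop p q c o1 # cs) ?st (3 * (ceil_log z - Suc i) + 1 + N) R A"
    by (rule Suc.hyps(1)[OF _ _ _ _ _ _ cont]) (use Suc.hyps(2) Suc.prems(1-5) i regs in auto)
  have test: "eval_test (RLess p q) st"
    using Suc.prems power_less_of_less_ceil_log[OF i] by simp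
  have upd: "rmem st c + rmem st o1 = 1 + real (Suc i)" "rmem st p + rmem st p = 2 ^ Suc i"
    using Suc.prems by simp_all
  have "simulates adj b (doubling_loop p q c o1 # cs) st
      (Suc (Suc (Suc (3 * (ceil_log z - Suc i) + 1 + N)))) R A"
    using loop unfolding doubling_loop_def
    by - (rule simulates_While_True[OF test], simp only: append.simps,
        rule simulates_det(7), rule simulates_det(7),
        simp only: set_state_simps fun_upd_apply regs if_False upd)
  then show ?case by (rule simulates_weaken) (use i in simp)
qed

lemma simulates_doubling_loop:
  assumes "p \<noteq> q" "c \<noteq> p" "c \<noteq> q" "o1 \<noteq> p" "o1 \<noteq> c"
    and "rmem st p = 1" "rmem st c = 1" "rmem st o1 = 1" "rmem st q = z"
    and "simulates adj b cs (set_r c (1 + real (ceil_log z)) (set_r p (2 ^ ceil_log z) st)) N R A"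
  shows "simulates adj b (doubling_loop p q c o1 # cs) st (3 * ceil_log z + 1 + N) R A"
  using simulates_doubling_loop_aux[of p q c o1 st 0 z adj b cs N R A] assms by simp

text \<open>Rounds up the real in \<open>q\<close>: a real and a natural register are incremented in
  step until the real one reaches it. The time is linear in the result, which is affordable for a
  walk length.\<close>

definition counting_loop :: "nat \<Rightarrow> nat \<Rightarrow> nat \<Rightarrow> nat \<Rightarrow> nat \<Rightarrow> stmt" where
  "counting_loop r q o1 x o2 = While (RLess r q) [Instr (RAdd r r o1), Instr (NAdd x x o2)]"

lemma simulates_counting_loop_aux:
  assumes regs: "r \<noteq> q" "o1 \<noteq> r" "x \<noteq> o2"
  shows "rmem st r = real i \<Longrightarrow> nmem st x = i \<Longrightarrow> rmem st o1 = 1 \<Longrightarrow> nmem st o2 = 1 \<Longrightarrow>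
    rmem st q = z \<Longrightarrow> i \<le> nat \<lceil>z\<rceil> \<Longrightarrow>
    simulates adj b cs (set_n x (nat \<lceil>z\<rceil>) (set_r r (real (nat \<lceil>z\<rceil>)) st)) N R A \<Longrightarrow>
    simulates adj b (counting_loop r q o1 x o2 # cs) st (3 * (nat \<lceil>z\<rceil> - i) + 1 + N) R A"
proof (induction "nat \<lceil>z\<rceil> - i" arbitrary: i st)
  case 0
  have i: "i = nat \<lceil>z\<rceil>" using 0(1,7) by linarith
  have "set_n x (nat \<lceil>z\<rceil>) (set_r r (real (nat \<lceil>z\<rceil>)) st) = st"
    using 0 i by (simp add: set_state_same)
  then have "simulates adj b cs st N R A" using 0 by simp
  moreover have "z \<le> real i" unfolding i by linarith
  then have "\<not> eval_test (RLess r q) st" using 0 by simp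
  ultimately have "simulates adj b (counting_loop r q o1 x o2 # cs) st (Suc N) R A"
    unfolding counting_loop_def by (intro simulates_While_False)
  then show ?case using i by simp
next
  case (Suc k)
  have i: "i < nat \<lceil>z\<rceil>" using Suc.hyps(2) by linarith
  then have iz: "real i < z" by linarith
  let ?st = "set_n x (Suc i) (set_r r (real (Suc i)) st)"
  have st: "set_n x (nat \<lceil>z\<rceil>) (set_r r (real (nat \<lceil>z\<rceil>)) ?st)
      = set_n x (nat \<lceil>z\<rceil>) (set_r r (real (nat \<lceil>z\<rceil>)) st)"
    by (simp add: set_state_commute set_state_overwrite)
  have cont: "simulates adj b cs (set_n x (nat \<lceil>z\<rceil>) (set_r r (real (nat \<lceil>z\<rceil>)) ?st)) N R A"
    unfolding st by (rule Suc.prems(7))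
  have loop: "simulates adj b (counting_loop r q o1 x o2 # cs) ?st (3 * (nat \<lceil>z\<rceil> - Suc i) + 1 + N) R A"
    by (rule Suc.hyps(1)[OF _ _ _ _ _ _ _ cont]) (use Suc.hyps(2) Suc.prems(1-6) i regs in auto)
  have test: "eval_test (RLess r q) st"
    using Suc.prems iz by simp
  have upd: "rmem st r + rmem st o1 = real (Suc i)" "nmem st x + nmem st o2 = Suc i"
    using Suc.prems by simp_all
  have "simulates adj b (counting_loop r q o1 x o2 # cs) st
      (Suc (Suc (Suc (3 * (nat \<lceil>z\<rceil> - Suc i) + 1 + N)))) R A"
    using loop unfolding counting_loop_def
    by - (rule simulates_While_True[OF test], simp only: append.simps,
        rule simulates_det(7), rule simulates_det(2), simp only: set_state_simps upd)
  then show ?case by (rule simulates_weaken) (use i in simp)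
qed

lemma simulates_counting_loop:
  assumes "r \<noteq> q" "o1 \<noteq> r" "x \<noteq> o2"
    and "rmem st r = 0" "nmem st x = 0" "rmem st o1 = 1" "nmem st o2 = 1" "rmem st q = z"
    and "simulates adj b cs (set_n x (nat \<lceil>z\<rceil>) (set_r r (real (nat \<lceil>z\<rceil>)) st)) N R A"
  shows "simulates adj b (counting_loop r q o1 x o2 # cs) st (3 * nat \<lceil>z\<rceil> + 1 + N) R A"
  using simulates_counting_loop_aux[of r q o1 x o2 st 0 z adj b cs N R A] assms by simp

text \<open>Register conventions of the program: the natural registers 2, 3 and 7 hold the constants 1, 0
  and 2; 4 holds the length \<open>s\<close> of a walk, 5 holds \<open>2 d\<close>, 8 the current vertex, 9 the number of
  remaining steps and 10 the position in the adjacency list that is searched. The real register 2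
  holds 1; 10 holds the (not rounded) number of walks, 11 the sum of the visited entries of \<open>b\<close> and 12
  the number of walks started.\<close>

definition degree_loop :: stmt where
  "degree_loop = While (NLess 3 6)
     [If (PNull 0) [Instr (NConst 6 0)] [Instr (PNext 0 0), Instr (NAdd 5 5 7)]]"

text \<open>Tests cannot be negated, so register 6 serves as a flag that is cleared at the end of
  the list. Each cell adds 2, so register 5 receives the range \<open>2 * d\<close> of the random
  draws directly.\<close>

lemma simulates_degree_loop:
  assumes "nmem st 3 = 0" "nmem st 6 = 1" "nmem st 7 = 2" "nmem st 5 = a" "pmem st 0 = l"
    and "simulates adj b cs (set_n 6 0 (set_n 5 (a + 2 * length l) (set_p 0 [] st))) N R A"
  shows "simulates adj b (degree_loop # cs) st (4 * length l + 4 + N) R A"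
  using assms
proof (induction l arbitrary: a st)
  case Nil
  have "set_n 6 0 (set_n 5 (a + 2 * length ([] :: nat list)) (set_p 0 [] st)) = set_n 6 0 st"
    using Nil by (simp add: set_state_same)
  then have "simulates adj b cs (set_n 6 0 st) N R A" using Nil by simp
  then have "simulates adj b (degree_loop # cs) st (Suc (Suc (Suc (Suc N)))) R A"
    unfolding degree_loop_def using Nil
    by - (rule simulates_While_True, simp, simp only: append.simps, rule simulates_If_True, simp,
        simp only: append.simps, rule simulates_det(1), rule simulates_While_False, simp_all)
  then show ?case by (rule simulates_weaken) simp
next
  case (Cons w l)
  let ?st = "set_n 5 (a + 2) (set_p 0 l st)"
  have st: "set_n 6 0 (set_n 5 (a + 2 + 2 * length l) (set_p 0 [] ?st))
      = set_n 6 0 (set_n 5 (a + 2 * length (w # l)) (set_p 0 [] st))"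
    by (simp add: set_state_commute set_state_overwrite)
  have cont: "simulates adj b cs (set_n 6 0 (set_n 5 (a + 2 + 2 * length l) (set_p 0 [] ?st))) N R A"
    unfolding st by (rule Cons.prems(6))
  have loop: "simulates adj b (degree_loop # cs) ?st (4 * length l + 4 + N) R A"
    by (rule Cons.IH[OF _ _ _ _ _ cont]) (use Cons.prems(1-5) in auto)
  then have "simulates adj b (degree_loop # cs) st (Suc (Suc (Suc (Suc (4 * length l + 4 + N))))) R A"
    unfolding degree_loop_def using Cons.prems(1-5)
    by - (rule simulates_While_True, simp, simp only: append.simps, rule simulates_If_False, simp,
        simp only: append.simps, rule simulates_det(16), rule simulates_det(2), simp)
  then show ?case by (rule simulates_weaken) simp
qed

definition skip_loop :: stmt where
  "skip_loop = While (NLess 3 10) [Instr (NSub 10 10 2), Instr (PNext 0 0)]"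

text \<open>As \<open>tl [] = []\<close>, moving past the end is harmless and leaves the null
  pointer; for \<open>k \<ge> d\<close> this signals that the walk stays.\<close>

lemma simulates_skip_loop:
  assumes "nmem st 3 = 0" "nmem st 2 = 1" "nmem st 10 = k" "pmem st 0 = l"
    and "simulates adj b cs (set_n 10 0 (set_p 0 (drop k l) st)) N R A"
  shows "simulates adj b (skip_loop # cs) st (3 * k + 1 + N) R A"
  using assms
proof (induction k arbitrary: l st)
  case 0
  have "set_n 10 0 (set_p 0 (drop 0 l) st) = st" using 0 by (simp add: set_state_same)
  then have "simulates adj b cs st N R A" using 0 by simp
  then have "simulates adj b (skip_loop # cs) st (Suc N) R A"
    unfolding skip_loop_def using 0 by (intro simulates_While_False) simp_all
  then show ?case by (rule simulates_weaken) simp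
next
  case (Suc k)
  let ?st = "set_p 0 (tl l) (set_n 10 k st)"
  have st: "set_n 10 0 (set_p 0 (drop k (tl l)) ?st) = set_n 10 0 (set_p 0 (drop (Suc k) l) st)"
    by (simp add: set_state_commute set_state_overwrite drop_Suc)
  have cont: "simulates adj b cs (set_n 10 0 (set_p 0 (drop k (tl l)) ?st)) N R A"
    unfolding st by (rule Suc.prems(5))
  have loop: "simulates adj b (skip_loop # cs) ?st (3 * k + 1 + N) R A"
    by (rule Suc.IH[OF _ _ _ _ cont]) (use Suc.prems(1-4) in auto)
  then have "simulates adj b (skip_loop # cs) st (Suc (Suc (Suc (3 * k + 1 + N)))) R A"
    unfolding skip_loop_def using Suc.prems(1-4)
    by - (rule simulates_While_True, simp, simp only: append.simps, rule simulates_det(3),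
        rule simulates_det(16), simp)
  then show ?case by (rule simulates_weaken) simp
qed

section \<open>The program\<close>

definition walk_loop :: stmt where
  "walk_loop = While (NLess 3 9)
     [Instr (NSub 9 9 2), Instr (ReadVec 13 8), Instr (RAdd 11 11 13), Instr (Rand 10 5),
      Instr (PStart 0 8), skip_loop, If (PNull 0) [] [Instr (PEntry 8 0)]]"

text \<open>The counter is compared with the unrounded number \<open>z\<close> of walks, which makes
  exactly \<open>nat \<lceil>z\<rceil>\<close> rounds. Register 3 holds 0, so the two
  \<open>NAdd\<close> are copies.\<close>

definition sampling_loop :: stmt where
  "sampling_loop = While (RLess 12 10)
     [Instr (RAdd 12 12 2), Instr (NAdd 8 1 3), Instr (NAdd 9 4 3), walk_loop]"

text \<open>Real register 3 receives \<open>n * kap / eps\<close>, 5 its logarithm plus 1, 6 the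
  unrounded walk length, 7 the rounded one (also in natural register 4), 9 its logarithm plus 1, and
  10 the unrounded number of walks. The degree is read off the list of the start vertex.\<close>

definition prepare :: "stmt list" where
  "prepare =
     [Instr (ROfNat 3 0), Instr (RMul 3 3 1), Instr (RDiv 3 3 0),
      Instr (RConst 4 1), Instr (RConst 5 1), doubling_loop 4 3 5 2,
      Instr (RMul 6 1 5), Instr (RAdd 6 6 6),
      Instr (RConst 7 0), Instr (NConst 4 0), counting_loop 7 6 2 4 2,
      Instr (RConst 8 1), Instr (RConst 9 1), doubling_loop 8 7 9 2,
      Instr (RConst 10 8), Instr (RMul 10 10 7), Instr (RMul 10 10 7), Instr (RMul 10 10 9),
      Instr (RDiv 10 10 0), Instr (RDiv 10 10 0),
      Instr (PStart 0 1), Instr (NConst 5 0), Instr (NConst 6 1), degree_loop,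
      Instr (RConst 11 0), Instr (RConst 12 0)]"

text \<open>For \<open>\<epsilon> \<ge> 1\<close> the estimate 0 is accurate enough, and for \<open>n = 1\<close> it is exact.\<close>

definition solver :: "stmt list" where
  "solver =
     [Instr (NConst 2 1), Instr (NConst 7 2), Instr (RConst 2 1),
      If (NLess 0 7) [Instr (RConst 0 0)]
        [If (RLess 0 2)
           (prepare @ [sampling_loop, Instr (ROfNat 13 5), Instr (RMul 13 13 12), Instr (RDiv 0 11 13)])
           [Instr (RConst 0 0)]]]"

text \<open>The registers on which the sampling phase relies and which a walk leaves unchanged;
  \<open>i\<close> is the number of walks started.\<close>

definition sampler_env :: "nat \<Rightarrow> nat \<Rightarrow> nat \<Rightarrow> real \<Rightarrow> nat \<Rightarrow> state \<Rightarrow> bool" where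
  "sampler_env u s d z i st \<longleftrightarrow> nmem st 1 = u \<and> nmem st 2 = 1 \<and> nmem st 3 = 0 \<and> nmem st 4 = s \<and>
     nmem st 5 = 2 * d \<and> rmem st 2 = 1 \<and> rmem st 10 = z \<and> rmem st 12 = real i"

text \<open>One round costs at most \<open>6 * d + 9\<close>: skipping takes 3 steps for each of
  fewer than \<open>2 * d\<close> cells, the rest is constant.\<close>

lemma simulates_walk_loop:
  assumes G: "simple_graph n E" "regular n E d" "adjacency_list n E adj" and d: "d > 0"
    and b: "dim_vec b = n"
  shows "sampler_env u s d z i st \<Longrightarrow> nmem st 8 = x \<Longrightarrow> x < n \<Longrightarrow> nmem st 9 = r \<Longrightarrow> rmem st 11 = acc \<Longrightarrow>
    simulates adj b [walk_loop] st (r * (6 * d + 9) + 1)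
      (\<lambda>st' y. sampler_env u s d z i st' \<and> rmem st' 11 = acc + y) (walk_sum adj d b r x)"
proof (induction r arbitrary: st x acc)
  case 0
  have "simulates adj b [walk_loop] st (Suc 0)
      (\<lambda>st' y. sampler_env u s d z i st' \<and> rmem st' 11 = acc + y) (return_pmf 0)"
    unfolding walk_loop_def using 0
    by - (rule simulates_While_False, simp add: sampler_env_def, rule simulates_Nil, simp)
  then show ?case by simp
next
  case (Suc r)
  note env = Suc.prems(1)[unfolded sampler_env_def]
  let ?R = "\<lambda>st' y. sampler_env u s d z i st' \<and> rmem st' 11 = acc + y"
  let ?A = "\<lambda>k. map_pmf ((+) (b $ x)) (walk_sum adj d b r (lazy_move adj d x k))"
  let ?st = "set_r 11 (acc + b $ x) (set_r 13 (b $ x) (set_n 9 r st))"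
  let ?tail = "[Instr (PStart 0 8), skip_loop, If (PNull 0) [] [Instr (PEntry 8 0)], walk_loop]"
  let ?N = "r * (6 * d + 9) + 1"
  have len: "length (adj x) = d" by (rule adjacency_list_length[OF G(2,3) Suc.prems(3)])
  have tail_k: "simulates adj b ?tail (set_n 10 k ?st) (Suc (3 * k + 1 + Suc (Suc ?N))) ?R (?A k)"
    if k: "k < 2 * d" for k
  proof -
    let ?st1 = "set_n 10 0 (set_p 0 (drop k (adj x)) (set_p 0 (adj x) (set_n 10 k ?st)))"
    have rest: "simulates adj b [If (PNull 0) [] [Instr (PEntry 8 0)], walk_loop] ?st1 (Suc (Suc ?N)) ?R (?A k)"
    proof (cases "k < d")
      case True
      have "simulates adj b [walk_loop] (set_n 8 (adj x ! k) ?st1) ?N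
          (\<lambda>st' y. sampler_env u s d z i st' \<and> rmem st' 11 = (acc + b $ x) + y)
          (walk_sum adj d b r (lazy_move adj d x k))"
        using env True Suc.prems lazy_move_less[OF G Suc.prems(3), of k]
        by (intro Suc.IH) (simp_all add: sampler_env_def lazy_move_def)
      then have after: "simulates adj b [walk_loop] (set_n 8 (adj x ! k) ?st1) ?N ?R (?A k)"
        by (intro simulates_map) (simp add: add.assoc)
      have ne: "drop k (adj x) \<noteq> []" "hd (drop k (adj x)) = adj x ! k"
        using True len by (simp_all add: hd_drop_conv_nth)
      show ?thesis
        by (rule simulates_If_False) (use ne after in \<open>auto intro!: simulates_det(17)\<close>)
    next
      \<comment> \<open>The skip has emptied the list, so the \<open>PNull\<close> branch leaves the
        current vertex as it is, in agreement with \<open>lazy_move\<close>.\<close>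
      case False
      have "simulates adj b [walk_loop] ?st1 ?N
          (\<lambda>st' y. sampler_env u s d z i st' \<and> rmem st' 11 = (acc + b $ x) + y)
          (walk_sum adj d b r (lazy_move adj d x k))"
        using env False Suc.prems
        by (intro Suc.IH) (simp_all add: sampler_env_def lazy_move_def)
      then have "simulates adj b [walk_loop] ?st1 ?N ?R (?A k)"
        by (intro simulates_map) (simp add: add.assoc)
      then have after: "simulates adj b ([] @ [walk_loop]) ?st1 (Suc ?N) ?R (?A k)"
        by - (rule simulates_weaken[where N = ?N], simp_all)
      show ?thesis
        by (rule simulates_If_True[OF _ after]) (use False len in simp)
    qed
    have "simulates adj b (skip_loop # [If (PNull 0) [] [Instr (PEntry 8 0)], walk_loop])
        (set_p 0 (adj x) (set_n 10 k ?st)) (3 * k + 1 + Suc (Suc ?N)) ?R (?A k)"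
      by (rule simulates_skip_loop[OF _ _ _ _ rest]) (use env in simp_all)
    then show ?thesis
      by - (rule simulates_det(15), use Suc.prems in simp)
  qed
  have tail: "simulates adj b ?tail (set_n 10 k ?st) (6 * d + 3 + ?N) ?R (?A k)" if "k < 2 * d" for k
    by (rule simulates_weaken[OF tail_k[OF that]]) (use that in simp)
  have n5: "nmem ?st 5 = 2 * d" using env by simp
  have rand: "simulates adj b (Instr (Rand 10 5) # ?tail) ?st (Suc (6 * d + 3 + ?N)) ?R
      (walk_sum adj d b (Suc r) x)"
    using simulates_Rand[of ?st 5 adj b ?tail 10 "6 * d + 3 + ?N" ?R ?A] tail d unfolding n5 by simp
  have "simulates adj b [walk_loop] st (Suc (Suc (Suc (Suc (Suc (6 * d + 3 + ?N)))))) ?R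
      (walk_sum adj d b (Suc r) x)"
    unfolding walk_loop_def
    apply (rule simulates_While_True)
    subgoal using env Suc.prems by simp
    apply (simp only: append.simps walk_loop_def[symmetric])
    apply (rule simulates_det(3), rule simulates_det(14), rule simulates_det(7))
    using rand env Suc.prems b by (simp del: walk_sum.simps)
  then show ?case by (rule simulates_weaken) simp
qed

text \<open>The state after a walk is random, so one walk and the remaining rounds are composed with
  \<open>simulates_append\<close>; \<open>iid_sum_Suc\<close> has the same shape.\<close>

lemma simulates_sampling_loop:
  assumes G: "simple_graph n E" "regular n E d" "adjacency_list n E adj" and d: "d > 0"
    and b: "dim_vec b = n" and u: "u < n"
  shows "sampler_env u s d z i st \<Longrightarrow> i \<le> nat \<lceil>z\<rceil> \<Longrightarrow> rmem st 11 = acc \<Longrightarrow>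
    simulates adj b [sampling_loop] st ((nat \<lceil>z\<rceil> - i) * (s * (6 * d + 9) + 5) + 1)
      (\<lambda>st' y. sampler_env u s d z (nat \<lceil>z\<rceil>) st' \<and> rmem st' 11 = acc + y)
      (iid_sum (walk_sum adj d b s u) (nat \<lceil>z\<rceil> - i))"
proof (induction "nat \<lceil>z\<rceil> - i" arbitrary: i st acc)
  case 0
  have i: "i = nat \<lceil>z\<rceil>" using 0(1,3) by linarith
  then have "\<not> real i < z" by linarith
  then have "simulates adj b [sampling_loop] st (Suc 0)
      (\<lambda>st' y. sampler_env u s d z (nat \<lceil>z\<rceil>) st' \<and> rmem st' 11 = acc + y) (return_pmf 0)"
    unfolding sampling_loop_def using 0(2,4) i
    by - (rule simulates_While_False, simp add: sampler_env_def, rule simulates_Nil, simp)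
  then show ?case using i by (simp add: iid_sum_0)
next
  case (Suc m)
  have i: "i < nat \<lceil>z\<rceil>" using Suc.hyps(2) by linarith
  then have iz: "real i < z" by linarith
  have m: "nat \<lceil>z\<rceil> - Suc i = m" "nat \<lceil>z\<rceil> - i = Suc m" using Suc.hyps(2) by linarith+
  note env = Suc.prems(1)[unfolded sampler_env_def]
  let ?c = "s * (6 * d + 9) + 5"
  let ?p = "walk_sum adj d b s u"
  let ?R = "\<lambda>st' y. sampler_env u s d z (nat \<lceil>z\<rceil>) st' \<and> rmem st' 11 = acc + y"
  let ?st = "set_n 9 s (set_n 8 u (set_r 12 (real (Suc i)) st))"
  have walk: "simulates adj b [walk_loop] ?st (s * (6 * d + 9) + 1)
      (\<lambda>st' y. sampler_env u s d z (Suc i) st' \<and> rmem st' 11 = acc + y) ?p"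
    by (rule simulates_walk_loop[OF G d b]) (use env Suc.prems u in \<open>simp_all add: sampler_env_def\<close>)
  have "simulates adj b [sampling_loop] st' (m * ?c + 1) ?R (map_pmf ((+) y) (iid_sum ?p m))"
    if st': "sampler_env u s d z (Suc i) st' \<and> rmem st' 11 = acc + y" for st' y
  proof (rule simulates_map)
    show "simulates adj b [sampling_loop] st' (m * ?c + 1)
       (\<lambda>st'' y'. sampler_env u s d z (nat \<lceil>z\<rceil>) st'' \<and> rmem st'' 11 = acc + (y + y')) (iid_sum ?p m)"
      using Suc.hyps(1)[of "Suc i" st' "acc + y"] m i st' by (simp add: add.assoc)
  qed
  then have "simulates adj b ([walk_loop] @ [sampling_loop]) ?st ((s * (6 * d + 9) + 1) + (m * ?c + 1)) ?R
      (bind_pmf ?p (\<lambda>y. map_pmf ((+) y) (iid_sum ?p m)))"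
    by (intro simulates_append[OF walk])
  then have loop: "simulates adj b [walk_loop, sampling_loop] ?st ((s * (6 * d + 9) + 1) + (m * ?c + 1)) ?R
      (iid_sum ?p (nat \<lceil>z\<rceil> - i))"
    unfolding m iid_sum_Suc by simp
  have upd: "rmem st 12 + rmem st 2 = real (Suc i)" "nmem st 1 + nmem st 3 = u" "nmem st 4 + nmem st 3 = s"
    using env by simp_all
  have test: "eval_test (RLess 12 10) st" using env iz by simp
  have "simulates adj b [sampling_loop] st
      (Suc (Suc (Suc (Suc ((s * (6 * d + 9) + 1) + (m * ?c + 1)))))) ?R (iid_sum ?p (nat \<lceil>z\<rceil> - i))"
    unfolding sampling_loop_def
    apply (rule simulates_While_True[OF test])
    apply (simp only: append.simps sampling_loop_def[symmetric])
    apply (rule simulates_det(7), rule simulates_det(2), rule simulates_det(2))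
    using loop by (simp add: upd upd(2)[unfolded One_nat_def])
  then show ?case by (rule simulates_weaken) (simp add: m)
qed

lemma init_state_simps [simp]:
  "nmem (init_state n u eps kap) = (\<lambda>_. 0)(0 := n, 1 := u)"
  "rmem (init_state n u eps kap) = (\<lambda>_. 0)(0 := eps, 1 := kap)"
  by (simp_all add: init_state_def)

lemma simulates_real_op:
  "rmem st y + rmem st z = c \<Longrightarrow> simulates adj b cs (set_r x c st) N R A
    \<Longrightarrow> simulates adj b (Instr (RAdd x y z) # cs) st (Suc N) R A"
  "rmem st y * rmem st z = c \<Longrightarrow> simulates adj b cs (set_r x c st) N R A
    \<Longrightarrow> simulates adj b (Instr (RMul x y z) # cs) st (Suc N) R A"
  "rmem st y / rmem st z = c \<Longrightarrow> simulates adj b cs (set_r x c st) N R A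
    \<Longrightarrow> simulates adj b (Instr (RDiv x y z) # cs) st (Suc N) R A"
  "real (nmem st y') = c \<Longrightarrow> simulates adj b cs (set_r x c st) N R A
    \<Longrightarrow> simulates adj b (Instr (ROfNat x y') # cs) st (Suc N) R A"
  by (auto intro: simulates_det(7,9,10,13))

text \<open>The constant 29 consists of 22 straight-line instructions and of 7 steps for leaving the
  four loops.\<close>

lemma simulates_prepare:
  assumes st: "nmem st 0 = n" "nmem st 1 = u" "nmem st 2 = 1" "nmem st 3 = 0" "nmem st 7 = 2"
      "rmem st 0 = eps" "rmem st 1 = kap" "rmem st 2 = 1"
    and len: "length (adj u) = d"
    and s: "s = walk_length eps kap n"
    and cont: "\<And>st'. sampler_env u s d (8 * (real s)\<^sup>2 * (1 + real (ceil_log (real s))) / eps\<^sup>2) 0 st' \<Longrightarrow>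
      rmem st' 11 = 0 \<Longrightarrow> simulates adj b cs st' N R A"
  shows "simulates adj b (prepare @ cs) st
    (3 * ceil_log (real n * kap / eps) + 3 * s + 3 * ceil_log (real s) + 4 * d + 29 + N) R A"
proof -
  note st = st st(2,7)[unfolded One_nat_def]
  let ?l = "real (ceil_log (real n * kap / eps))"
  have s': "s = nat \<lceil>2 * kap * (1 + ?l)\<rceil>" unfolding s walk_length_def ..
  show ?thesis
    apply (rule simulates_weaken)
     apply (unfold prepare_def append.simps)
    apply (rule simulates_real_op(4)[where c = "real n"], simp add: st)
    apply (rule simulates_real_op(2)[where c = "real n * kap"], simp add: st)
    apply (rule simulates_real_op(3)[where c = "real n * kap / eps"], simp add: st)
    apply (rule simulates_det(6), rule simulates_det(6))
    apply (rule simulates_doubling_loop[where z = "real n * kap / eps"])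
             apply (simp_all add: st)[9]
    apply (rule simulates_real_op(2)[where c = "kap * (1 + ?l)"], simp add: st)
    apply (rule simulates_real_op(1)[where c = "2 * kap * (1 + ?l)"], simp add: st)
    apply (rule simulates_det(6), rule simulates_det(1))
    apply (rule simulates_counting_loop[where z = "2 * kap * (1 + ?l)"])
            apply (simp_all add: st)[8]
    apply (fold s')
    apply (rule simulates_det(6), rule simulates_det(6))
    apply (rule simulates_doubling_loop[where z = "real s"])
             apply (simp_all add: st)[9]
    apply (rule simulates_det(6))
    apply (rule simulates_real_op(2)[where c = "8 * real s"], simp add: st)
    apply (rule simulates_real_op(2)[where c = "8 * (real s)\<^sup>2"], simp add: st power2_eq_square)
    apply (rule simulates_real_op(2)[where c = "8 * (real s)\<^sup>2 * (1 + real (ceil_log (real s)))"], simp add: st)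
    apply (rule simulates_real_op(3)[where c = "8 * (real s)\<^sup>2 * (1 + real (ceil_log (real s))) / eps"], simp add: st)
    apply (rule simulates_real_op(3)[where c = "8 * (real s)\<^sup>2 * (1 + real (ceil_log (real s))) / eps\<^sup>2"], simp add: st power2_eq_square)
    apply (rule simulates_det(15), rule simulates_det(1), rule simulates_det(1))
    apply (rule simulates_degree_loop[where l = "adj u" and a = 0])
         apply (simp_all add: st)[5]
    apply (rule simulates_det(6), rule simulates_det(6))
    apply (rule cont)
     apply (simp_all add: sampler_env_def st len)
    done
qed

lemma simulates_solver_zero:
  assumes "n < 2 \<or> eps \<ge> 1"
  shows "simulates adj b solver (init_state n u eps kap) 6 (\<lambda>st y. rmem st 0 = y) (return_pmf 0)"
proof -
  have zero: "simulates adj b [Instr (RConst 0 0)] st 1 (\<lambda>st y. rmem st 0 = y) (return_pmf 0)" for st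
    unfolding One_nat_def by (rule simulates_det(6), rule simulates_Nil) simp
  show ?thesis
  proof (cases "n < 2")
    case True
    show ?thesis
      unfolding solver_def
      apply (rule simulates_weaken)
       apply (rule simulates_det(1), rule simulates_det(1), rule simulates_det(6))
       apply (rule simulates_If_True)
        apply (use True in simp)
       apply (simp only: append.simps, rule zero)
      apply simp
      done
  next
    case False
    then have "eps \<ge> 1" using assms by simp
    show ?thesis
      unfolding solver_def
      apply (rule simulates_weaken)
       apply (rule simulates_det(1), rule simulates_det(1), rule simulates_det(6))
       apply (rule simulates_If_False)
        apply (use False in simp)
       apply (simp only: append.simps)
       apply (rule simulates_If_False)
        apply (use \<open>eps \<ge> 1\<close> in simp)
       apply (simp only: append.simps, rule zero)
      apply simp
      done
  qed
qed

text \<open>The sums of \<open>m\<close> walks estimate \<open>2 * d * m\<close> times the solution,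
  whence the final division. The constant 38 is 29 for the preparation, 5 before it, 1 for leaving
  the sampling loop and 3 after it.\<close>

lemma simulates_solver:
  assumes G: "simple_graph n E" "regular n E d" "adjacency_list n E adj" and d: "d > 0"
    and b: "dim_vec b = n" and u: "u < n" and n: "n \<ge> 2" and eps: "eps < 1"
    and s: "s = walk_length eps kap n" and m: "m = num_walks eps s"
  shows "simulates adj b solver (init_state n u eps kap)
    (3 * ceil_log (real n * kap / eps) + 3 * s + 3 * ceil_log (real s) + 4 * d + m * (s * (6 * d + 9) + 5) + 38)
    (\<lambda>st y. rmem st 0 = y)
    (map_pmf (\<lambda>z. z / (2 * real d * real m)) (iid_sum (walk_sum adj d b s u) m))"
proof -
  let ?tail = "[Instr (ROfNat 13 5), Instr (RMul 13 13 12), Instr (RDiv 0 11 13)]"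
  let ?z = "8 * (real s)\<^sup>2 * (1 + real (ceil_log (real s))) / eps\<^sup>2"
  let ?A = "iid_sum (walk_sum adj d b s u) m" and ?f = "\<lambda>z. z / (2 * real d * real m)"
  let ?R = "\<lambda>st y. rmem st 0 = y"
  have mz: "m = nat \<lceil>?z\<rceil>" unfolding m num_walks_def ..
  have tail: "simulates adj b ?tail st' 3 ?R (return_pmf (?f y))"
    if "sampler_env u s d ?z m st' \<and> rmem st' 11 = 0 + y" for st' y
    unfolding numeral_3_eq_3
    by (rule simulates_real_op(4)[where c = "2 * real d"],
        use that in \<open>simp add: sampler_env_def\<close>,
        rule simulates_real_op(2)[where c = "2 * real d * real m"],
        use that in \<open>simp add: sampler_env_def\<close>,
        rule simulates_real_op(3)[where c = "?f y"],
        use that in simp, rule simulates_Nil, simp)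
  have main: "simulates adj b ([sampling_loop] @ ?tail) st' ((m * (s * (6 * d + 9) + 5) + 1) + 3) ?R (map_pmf ?f ?A)"
    if "sampler_env u s d ?z 0 st'" "rmem st' 11 = 0" for st'
  proof -
    have "simulates adj b [sampling_loop] st' (m * (s * (6 * d + 9) + 5) + 1)
        (\<lambda>st' y. sampler_env u s d ?z m st' \<and> rmem st' 11 = 0 + y) ?A"
      using simulates_sampling_loop[OF G d b u that(1) _ that(2)] unfolding mz[symmetric] by simp
    then show ?thesis unfolding map_pmf_def by (rule simulates_append) (rule tail)
  qed
  have len: "length (adj u) = d" by (rule adjacency_list_length[OF G(2,3) u])
  show ?thesis
    unfolding solver_def
    apply (rule simulates_weaken)
     apply (rule simulates_det(1), rule simulates_det(1), rule simulates_det(6))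
     apply (rule simulates_If_False)
      apply (use n in simp)
     apply (simp only: append.simps)
     apply (rule simulates_If_True)
      apply (use eps in simp)
     apply (simp only: append_Nil2)
     apply (rule simulates_prepare[where n = n and u = u and eps = eps and kap = kap and s = s and d = d])
               apply (simp_all add: len s[symmetric])[10]
     apply (rule main[simplified append.simps], assumption, assumption)
    apply simp
    done
qed

text \<open>Since \<open>m\<close>, \<open>s\<close> and \<open>d\<close> are at least 1, every
  summand is at most a constant times \<open>P = m * s * d\<close>, with total constant 72. Then
  \<open>3240 = 72 * 45\<close>, the 45 coming from the bound on \<open>m\<close>.\<close>

lemma solver_time_bound:
  assumes "d > 0" "0 < eps" "eps < 1" "kap \<ge> 1" and s: "s = walk_length eps kap n" and m: "m = num_walks eps s"
  shows "real (3 * ceil_log (real n * kap / eps) + 3 * s + 3 * ceil_log (real s) + 4 * d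
      + m * (s * (6 * d + 9) + 5) + 38) \<le> 3240 * time_order d eps s"
proof -
  have L: "2 + 2 * ceil_log (real n * kap / eps) \<le> s"
    unfolding s by (rule walk_length_ge_logs[OF assms(4)])
  then have s2: "2 \<le> s" by linarith
  have "real s \<le> 2 ^ s" by (simp add: less_imp_le)
  then have K: "ceil_log (real s) \<le> s" by (rule ceil_log_le)
  have m1: "1 \<le> m" unfolding m by (rule num_walks_bounds[OF s2 assms(2,3)])
  define P where "P = m * s * d"
  have ms: "1 \<le> m * s" using m1 s2 by simp
  have "m * s * 1 \<le> P" unfolding P_def using assms(1) by (intro mult_le_mono) auto
  moreover have "1 * s \<le> m * s" "m * 1 \<le> m * s" using m1 s2 by (auto intro!: mult_le_mono simp del: One_nat_def)
  moreover have "1 * d \<le> P" unfolding P_def using ms by (intro mult_le_mono) auto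
  moreover have "m * (s * (6 * d + 9) + 5) = 6 * P + 9 * (m * s) + 5 * m"
    unfolding P_def by (simp add: algebra_simps)
  ultimately have "3 * ceil_log (real n * kap / eps) + 3 * s + 3 * ceil_log (real s) + 4 * d
      + m * (s * (6 * d + 9) + 5) + 38 \<le> 72 * P"
    using L K s2 m1 assms(1) by linarith
  then have "real (3 * ceil_log (real n * kap / eps) + 3 * s + 3 * ceil_log (real s) + 4 * d
      + m * (s * (6 * d + 9) + 5) + 38) \<le> real (72 * P)" by (simp only: of_nat_le_iff)
  also have "\<dots> = 72 * (real m * (real s * real d))" unfolding P_def by simp
  also have "\<dots> \<le> 72 * (45 * (real s)\<^sup>2 * ln (real s) / eps\<^sup>2 * (real s * real d))"
    unfolding m using num_walks_bounds(2)[OF s2 assms(2,3)]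
    by (intro mult_left_mono mult_right_mono) auto
  also have "\<dots> = 3240 * (real d * inverse (eps\<^sup>2) * real s ^ 3 * ln (real s))"
    by (simp add: divide_inverse power2_eq_square power3_eq_cube)
  also have "\<dots> \<le> 3240 * time_order d eps s" unfolding time_order_def by simp
  finally show ?thesis .
qed

section \<open>Degenerate inputs and the guarantee for all inputs\<close>

lemma positive_degree:
  assumes "simple_graph n E" "graph_connected n E" "regular n E d" "n \<ge> 2"
  shows "d > 0"
proof (rule ccontr)
  assume "\<not> d > 0"
  have "E `` {v} = {}" if "v < n" for v
  proof -
    \<comment> \<open>The cardinality of an infinite set is 0 too, so finiteness is established
      before degree 0 can mean that there are no neighbours.\<close>
    have "E `` {v} \<subseteq> {..<n}" using assms(1) by (auto simp: simple_graph_def)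
    then have "finite (E `` {v})" by (rule finite_subset) simp
    moreover have "card (E `` {v}) = 0"
      using assms(3) that \<open>\<not> d > 0\<close> by (simp add: regular_def degree_def)
    ultimately show ?thesis by simp
  qed
  then have "E = {}" using assms(1) by (auto simp: simple_graph_def)
  moreover have "(0, 1) \<in> E\<^sup>*" using assms(2,4) by (simp add: graph_connected_def)
  ultimately show False by simp
qed

text \<open>Without edges the Laplacian is 0, so its range forces \<open>b = 0\<close>. This case
  stands apart because the condition number of the zero matrix is unspecified and the spectral gap
  argument requires \<open>d > 0\<close>.\<close>

lemma pinv_laplacian_single_vertex:
  assumes G: "simple_graph 1 E" and b: "b \<in> mat_range (laplacian 1 E)"
  shows "(pinv (laplacian 1 E) *\<^sub>v b) $ 0 = 0"
proof -
  have E: "E = {}" using G by (auto simp: simple_graph_def irrefl_def)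
  obtain y where y: "y \<in> carrier_vec 1" "b = laplacian 1 E *\<^sub>v y"
    using b unfolding mat_range_def by (auto simp: carrier_matD(2)[OF laplacian_carrier])
  have "b $ 0 = 0"
    unfolding y(2) using laplacian_mult_vec[OF G, of 0 0 y] y(1) E
    by (simp add: regular_def degree_def)
  moreover have "dim_vec b = 1" unfolding y(2) by (simp add: carrier_matD(1)[OF laplacian_carrier])
  moreover have "dim_row (pinv (laplacian 1 E)) = 1"
    using pinv_eigendecomposition[OF laplacian_carrier laplacian_symmetric[OF G]]
    by (metis carrier_matD(1) sum_outer_carrier)
  ultimately show ?thesis by (simp add: scalar_prod_def)
qed

lemma solver_correct:
  assumes G: "simple_graph n E" "regular n E d" "adjacency_list n E adj" and conn: "graph_connected n E"
    and b: "b \<in> mat_range (laplacian n E)" and eps: "eps > 0"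
    and kap: "kap \<ge> 1" "condition_number (laplacian n E) \<le> kap"
    and xs: "xs = pinv (laplacian n E) *\<^sub>v b" and u: "u < n" and s: "s = walk_length eps kap n"
  shows "\<exists>T. real T \<le> 3240 * time_order d eps s \<and> halts_within solver n adj b u eps kap T \<and>
    measure_pmf.prob (output_dist solver n adj b u eps kap T) {y. \<bar>y - xs $ u\<bar> \<le> eps * linf_norm xs}
      \<ge> 1 - 1 / real s"
proof -
  note sol = pinv_laplacian_solution[OF G(1,2) b xs]
  have xs_n: "dim_vec xs = n" using sol(2) by simp
  define M where "M = linf_norm xs"
  have M0: "M \<ge> 0" unfolding M_def using linf_norm_ge[of u xs] u xs_n by auto
  show ?thesis
  proof (cases "n < 2 \<or> eps \<ge> 1")
    case True
    have acc: "\<bar>0 - xs $ u\<bar> \<le> eps * M"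
    proof (cases "eps \<ge> 1")
      case True
      have "\<bar>xs $ u\<bar> \<le> 1 * M" unfolding M_def using linf_norm_ge[of u xs] u xs_n by simp
      also have "\<dots> \<le> eps * M" using True M0 by (rule mult_right_mono)
      finally show ?thesis by simp
    next
      case False
      then have n1: "n = 1" "u = 0" using \<open>n < 2 \<or> eps \<ge> 1\<close> u by auto
      have "xs $ u = 0"
        unfolding xs n1 using pinv_laplacian_single_vertex[of E b] G(1) b unfolding n1 by simp
      then show ?thesis using M0 eps by simp
    qed
    note run = simulates_run[OF simulates_solver_zero[OF True, of adj b u kap]]
    have "measure_pmf.prob (output_dist solver n adj b u eps kap 6) {y. \<bar>y - xs $ u\<bar> \<le> eps * M} = 1"
      unfolding run(2) using acc by (subst measure_pmf.prob_eq_1) (auto simp: AE_measure_pmf_iff)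
    \<comment> \<open>The \<open>max 1\<close> in \<open>time_order\<close> pays for these
      constantly many steps, even for a single vertex, where \<open>d = 0\<close>.\<close>
    moreover have "real 6 \<le> 3240 * time_order d eps s" unfolding time_order_def by simp
    ultimately show ?thesis using run(1) unfolding M_def by (intro exI[of _ 6]) simp
  next
    case False
    then have n: "n \<ge> 2" and eps1: "eps < 1" by auto
    have d: "d > 0" by (rule positive_degree[OF G(1) conn G(2) n])
    have s2: "s \<ge> 2" unfolding s using walk_length_order(1)[OF eps kap(1)] n by simp
    obtain e :: "nat \<Rightarrow> nat \<Rightarrow> real" where e0: "\<And>a. a < n \<Longrightarrow> e 0 a = xs $ a"
      and eSuc: "\<And>r a. a < n \<Longrightarrow> 2 * real d * e (Suc r) a = real d * e r a + (\<Sum>w\<in>E `` {a}. e r w)"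
      and e_le: "\<And>r a. a < n \<Longrightarrow> \<bar>e r a\<bar> \<le> (1 - 1 / (2 * kap)) ^ r * (sqrt (real n) * linf_norm xs)"
      using sol(3)[OF d kap] by blast
    have b_eq: "b $ a = real d * xs $ a - (\<Sum>w\<in>E `` {a}. xs $ w)" if "a < n" for a
      using laplacian_mult_vec[OF G(1,2) that sol(2)] unfolding sol(1) .
    have b_le: "\<bar>b $ a\<bar> \<le> 2 * real d * M" if a: "a < n" for a
    proof -
      have "\<bar>real d * xs $ a\<bar> \<le> real d * M"
        unfolding M_def abs_mult using linf_norm_ge[of a xs] a xs_n by (intro mult_mono) auto
      moreover have "\<bar>\<Sum>w\<in>E `` {a}. xs $ w\<bar> \<le> real d * M"
        unfolding M_def by (rule sum_neighbours_abs_le[OF G(1,2) a sol(2)])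
      ultimately show ?thesis unfolding b_eq[OF a] by linarith
    qed
    define p where "p = walk_sum adj d b s u"
    have p_le: "\<bar>y\<bar> \<le> real s * (2 * real d * M)" if "y \<in> set_pmf p" for y
      using walk_sum_bounded[OF G d b_le u] that unfolding p_def by simp
    have mean: "measure_pmf.expectation p (\<lambda>y. y) = 2 * real d * (xs $ u - e s u)"
      unfolding p_def by (rule walk_sum_expectation[OF G d b_eq e0 eSuc u])
    have "\<bar>e s u\<bar> \<le> ((1 - 1 / (2 * kap)) ^ s * sqrt (real n)) * M"
      using e_le[OF u, of s] unfolding M_def by (simp add: mult.assoc)
    also have "\<dots> \<le> eps / 2 * M"
      using walk_length_decay[OF eps kap(1), of n] n M0 unfolding s by (intro mult_right_mono) auto
    \<comment> \<open>Dividing the expectation by \<open>2 * d\<close> gives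
      \<open>xs $ u - e s u\<close>, so the bias is exactly the remainder
      \<open>e s u\<close>.\<close>
    finally have bias: "\<bar>measure_pmf.expectation p (\<lambda>y. y) / (2 * real d) - xs $ u\<bar> \<le> eps / 2 * M"
      unfolding mean using d by simp
    define m where "m = num_walks eps s"
    have m1: "m > 0" unfolding m_def using num_walks_bounds(1)[OF s2 eps eps1] by simp
    have prob: "measure_pmf.prob (map_pmf (\<lambda>z. z / (2 * real d * real m)) (iid_sum p m))
        {y. \<bar>y - xs $ u\<bar> \<le> eps * M} \<ge> 1 - 1 / real s"
      by (rule walk_estimator_accuracy[OF p_le bias d s2 eps M0 m1 exp_ceil_log])
        (simp_all add: m_def num_walks_ge)
    have dim_b: "dim_vec b = n"
      using sol(1) by (metis carrier_matD(1) dim_mult_mat_vec laplacian_carrier)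
    note run = simulates_run[OF simulates_solver[OF G d dim_b u n eps1 s m_def]]
    show ?thesis
      using solver_time_bound[OF d eps eps1 kap(1) s m_def] run(1) prob
      unfolding run(2)[symmetric] p_def M_def by blast
  qed
qed

theorem theorem1p1:
  shows "\<exists>(prog :: stmt list) (s :: real \<Rightarrow> real \<Rightarrow> nat \<Rightarrow> nat).
    (\<exists>c1 > 0. \<exists>c2 :: real. \<forall>eps > 0. \<forall>kap \<ge> 1. \<forall>n \<ge> 1.
        2 \<le> s eps kap n \<and>
        c1 * s_order eps kap n \<le> real (s eps kap n) \<and>
        real (s eps kap n) \<le> c2 * s_order eps kap n) \<and>
    (\<exists>c3 :: real. \<forall>n d E adj b eps kap.
        simple_graph n E \<and> graph_connected n E \<and> regular n E d \<and> adjacency_list n E adj \<and>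
        b \<in> mat_range (laplacian n E) \<and> eps > 0 \<and>
        kap \<ge> 1 \<and> condition_number (laplacian n E) \<le> kap \<longrightarrow>
        (let xs = pinv (laplacian n E) *\<^sub>v b; sv = s eps kap n in
          laplacian n E *\<^sub>v xs = b \<and>
          (\<forall>u<n. \<exists>T.
            real T \<le> c3 * time_order d eps sv \<and>
            halts_within prog n adj b u eps kap T \<and>
            measure_pmf.prob (output_dist prog n adj b u eps kap T)
              {y. \<bar>y - xs $ u\<bar> \<le> eps * linf_norm xs} \<ge> 1 - 1 / real sv)))"
proof (intro exI[of _ solver] exI[of _ walk_length] conjI)
  show "\<exists>c1 > 0. \<exists>c2 :: real. \<forall>eps > 0. \<forall>kap \<ge> 1. \<forall>n \<ge> 1.
        2 \<le> walk_length eps kap n \<and>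
        c1 * s_order eps kap n \<le> real (walk_length eps kap n) \<and>
        real (walk_length eps kap n) \<le> c2 * s_order eps kap n"
    using walk_length_order by (intro exI[of _ 1] conjI exI[of _ 12]) simp_all
  show "\<exists>c3 :: real. \<forall>n d E adj b eps kap.
        simple_graph n E \<and> graph_connected n E \<and> regular n E d \<and> adjacency_list n E adj \<and>
        b \<in> mat_range (laplacian n E) \<and> eps > 0 \<and>
        kap \<ge> 1 \<and> condition_number (laplacian n E) \<le> kap \<longrightarrow>
        (let xs = pinv (laplacian n E) *\<^sub>v b; sv = walk_length eps kap n in
          laplacian n E *\<^sub>v xs = b \<and>
          (\<forall>u<n. \<exists>T.
            real T \<le> c3 * time_order d eps sv \<and>
            halts_within solver n adj b u eps kap T \<and>
            measure_pmf.prob (output_dist solver n adj b u eps kap T)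
              {y. \<bar>y - xs $ u\<bar> \<le> eps * linf_norm xs} \<ge> 1 - 1 / real sv))"
    unfolding Let_def
    by (rule exI[of _ 3240], intro allI impI, elim conjE, intro conjI allI impI)
      (assumption | rule pinv_laplacian_solution(1)[OF _ _ _ refl]
        | rule solver_correct[OF _ _ _ _ _ _ _ _ refl _ refl])+
qed

end
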